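(* Let $a>0$, $\sigma>1$, $0\leq s<1$, and let $\theta_0\in \dot H^s_{a,\sigma}(\mathbb{R}^2)\cap L^2(\mathbb{R}^2)$. There is a positive constant $C'_{a,\sigma,s}$ such that if $\|\theta_0\|_{\dot H^s_{a,\sigma}}<C'_{a,\sigma,s}$, then the unique global solution $\theta\in \widetilde{L^\infty}(\mathbb{R}^+,\dot H^s_{a,\sigma}(\mathbb{R}^2))\cap L^2(\mathbb{R}^+,\dot H^{s+\frac12}_{a,\sigma}(\mathbb{R}^2))$ of the critical quasi-geostrophic equation $$\partial_t\theta+|D|\theta+u_\theta\cdot\nabla\theta=0 \ \text{ in } \mathbb{R}^+\times\mathbb{R}^2,\qquad \theta(0)=\theta_0,$$ satisfies $$\lim_{t\to\infty}\|\theta(t)\|_{L^2}=0$$ and $$\limsup_{t\to\infty} t^{\kappa}\|\theta(t)\|_{\dot H^{\kappa}_{a,\sigma}}=0\quad\text{for every }\kappa\geq 0.$$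
   Context: Notation: $\widehat f$ is the Fourier transform of $f$ and $|D|=(-\Delta)^{1/2}$ is the Fourier multiplier $\widehat{|D|f}(\xi)=|\xi|\widehat f(\xi)$. The velocity is $u_\theta=(\partial_2(-\Delta)^{-1/2}\theta,\,-\partial_1(-\Delta)^{-1/2}\theta)$, so that $\operatorname{div}u_\theta=0$ and $|\widehat{u_\theta}|=|\widehat\theta|$. For $\kappa\in\mathbb{R}$, $a>0$, $\sigma>1$, the homogeneous Gevrey–Sobolev space $\dot H^\kappa_{a,\sigma}(\mathbb{R}^2)$ consists of tempered distributions $f$ with $\widehat f\in L^1_{loc}$ and $$\|f\|_{\dot H^\kappa_{a,\sigma}}^2=\int_{\mathbb{R}^2}|\xi|^{2\kappa}e^{2a|\xi|^{1/\sigma}}|\widehat f(\xi)|^2\,d\xi<\infty .$$ The Chemin–Lerner type space $\widetilde{L^\infty}(\mathbb{R}^+,\dot H^s_{a,\sigma})$ is normed by $\|f\|^2=\int_{\mathbb{R}^2}|\xi|^{2s}e^{2a|\xi|^{1/\sigma}}\sup_{t\geq0}|\widehat f(t,\xi)|^2\,d\xi$, and $L^2(\mathbb{R}^+,\dot H^{s+1/2}_{a,\sigma})$ has the usual Bochner norm. A solution is understood in the mild sense: $\theta(t)=e^{-t|D|}\theta_0-\int_0^t e^{-(t-z)|D|}\operatorname{div}(\theta u_\theta)(z)\,dz$. It is known (and used as part of the setting) that for $\|\theta_0\|_{\dot H^s_{a,\sigma}}$ small enough such a solution exists uniquely in the stated space. *)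

theory Defs
  imports "HOL-Analysis.Analysis"
begin

text \<open>Everything is formulated on the Fourier side.  A function on R^2 is represented by
its Fourier transform, a map  real^2 => complex, with the convention
  hat f (xi) = integral of exp(-i x.xi) f(x) dx,
so that hat (d_j f) = i xi_j hat f,  hat (f g) = (2 pi)^(-2) (hat f * hat g),
and  ||f||_{L^2} = (2 pi)^(-1) ||hat f||_{L^2}  (Plancherel).\<close>

definition ennsqrt :: "ennreal \<Rightarrow> ennreal" where
  "ennsqrt x = (if x = \<infinity> then \<infinity> else ennreal (sqrt (enn2real x)))"

definition gev_weight :: "real \<Rightarrow> real \<Rightarrow> real \<Rightarrow> real^2 \<Rightarrow> real" where
  "gev_weight a \<sigma> \<kappa> \<xi> = norm \<xi> powr (2 * \<kappa>) * exp (2 * a * norm \<xi> powr (1 / \<sigma>))"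

definition gev_sq :: "real \<Rightarrow> real \<Rightarrow> real \<Rightarrow> (real^2 \<Rightarrow> complex) \<Rightarrow> ennreal" where
  "gev_sq a \<sigma> \<kappa> fh = (\<integral>\<^sup>+ \<xi>. ennreal (gev_weight a \<sigma> \<kappa> \<xi> * (cmod (fh \<xi>))\<^sup>2) \<partial>lborel)"

definition gev_norm :: "real \<Rightarrow> real \<Rightarrow> real \<Rightarrow> (real^2 \<Rightarrow> complex) \<Rightarrow> ennreal" where
  "gev_norm a \<sigma> \<kappa> fh = ennsqrt (gev_sq a \<sigma> \<kappa> fh)"

definition in_Hdot :: "real \<Rightarrow> real \<Rightarrow> real \<Rightarrow> (real^2 \<Rightarrow> complex) \<Rightarrow> bool" where
  "in_Hdot a \<sigma> \<kappa> fh \<longleftrightarrow> fh \<in> borel_measurable lborel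
     \<and> (\<forall>K. compact K \<longrightarrow> set_integrable lborel K fh)
     \<and> gev_sq a \<sigma> \<kappa> fh < \<infinity>"

definition L2_sq :: "(real^2 \<Rightarrow> complex) \<Rightarrow> ennreal" where
  "L2_sq fh = (\<integral>\<^sup>+ \<xi>. ennreal ((cmod (fh \<xi>))\<^sup>2) \<partial>lborel)"

text \<open>L^2 norm of f, computed from hat f by Plancherel.\<close>
definition L2_norm :: "(real^2 \<Rightarrow> complex) \<Rightarrow> ennreal" where
  "L2_norm fh = ennreal (1 / (2 * pi)) * ennsqrt (L2_sq fh)"

definition in_L2 :: "(real^2 \<Rightarrow> complex) \<Rightarrow> bool" where
  "in_L2 fh \<longleftrightarrow> fh \<in> borel_measurable lborel \<and> L2_sq fh < \<infinity>"

definition real_valued_hat :: "(real^2 \<Rightarrow> complex) \<Rightarrow> bool" where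
  "real_valued_hat fh \<longleftrightarrow> (AE \<xi> in lborel. fh (- \<xi>) = cnj (fh \<xi>))"

definition CL_sq :: "real \<Rightarrow> real \<Rightarrow> real \<Rightarrow> (real \<Rightarrow> real^2 \<Rightarrow> complex) \<Rightarrow> ennreal" where
  "CL_sq a \<sigma> s th = (\<integral>\<^sup>+ \<xi>. ennreal (gev_weight a \<sigma> s \<xi>) *
        (SUP t\<in>{0..}. ennreal ((cmod (th t \<xi>))\<^sup>2)) \<partial>lborel)"

definition L2time_sq :: "real \<Rightarrow> real \<Rightarrow> real \<Rightarrow> (real \<Rightarrow> real^2 \<Rightarrow> complex) \<Rightarrow> ennreal" where
  "L2time_sq a \<sigma> \<kappa> th = (\<integral>\<^sup>+ t. indicator {0..} t * gev_sq a \<sigma> \<kappa> (th t) \<partial>lborel)"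

definition in_sol_space :: "real \<Rightarrow> real \<Rightarrow> real \<Rightarrow> (real \<Rightarrow> real^2 \<Rightarrow> complex) \<Rightarrow> bool" where
  "in_sol_space a \<sigma> s th \<longleftrightarrow>
     (\<lambda>p. th (fst p) (snd p)) \<in> borel_measurable (lborel \<Otimes>\<^sub>M lborel)
     \<and> (\<forall>t\<ge>0. in_Hdot a \<sigma> s (th t))
     \<and> CL_sq a \<sigma> s th < \<infinity>
     \<and> L2time_sq a \<sigma> (s + 1/2) th < \<infinity>"

text \<open>Fourier symbol of div(theta u_theta):
  hat(div(theta u_theta))(xi) = (2 pi)^(-2) int qg_kernel xi eta * hat theta(xi - eta) * hat theta(eta) d eta,
  where hat u_theta(eta) = (i eta_2/|eta|, - i eta_1/|eta|) hat theta(eta).\<close>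
definition qg_kernel :: "real^2 \<Rightarrow> real^2 \<Rightarrow> real" where
  "qg_kernel \<xi> \<eta> = - ((\<xi>$1 * \<eta>$2 - \<xi>$2 * \<eta>$1) / norm \<eta>)"

definition qg_integrand :: "(real \<Rightarrow> real^2 \<Rightarrow> complex) \<Rightarrow> real \<Rightarrow> real^2 \<Rightarrow> real^2 \<Rightarrow> complex" where
  "qg_integrand th z \<xi> \<eta> = complex_of_real (qg_kernel \<xi> \<eta>) * th z (\<xi> - \<eta>) * th z \<eta>"

definition div_nonlin :: "(real \<Rightarrow> real^2 \<Rightarrow> complex) \<Rightarrow> real \<Rightarrow> real^2 \<Rightarrow> complex" where
  "div_nonlin th z \<xi> = complex_of_real (1 / (4 * pi\<^sup>2)) * (\<integral>\<eta>. qg_integrand th z \<xi> \<eta> \<partial>lborel)"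

definition is_mild_sol :: "(real^2 \<Rightarrow> complex) \<Rightarrow> (real \<Rightarrow> real^2 \<Rightarrow> complex) \<Rightarrow> bool" where
  "is_mild_sol th0 th \<longleftrightarrow> (\<forall>t\<ge>0. AE \<xi> in lborel.
      (AE z in lborel. z \<in> {0..t} \<longrightarrow> integrable lborel (qg_integrand th z \<xi>))
    \<and> set_integrable lborel {0..t}
         (\<lambda>z. complex_of_real (exp (- (t - z) * norm \<xi>)) * div_nonlin th z \<xi>)
    \<and> th t \<xi> = complex_of_real (exp (- t * norm \<xi>)) * th0 \<xi>
         - (\<integral>z\<in>{0..t}. complex_of_real (exp (- (t - z) * norm \<xi>)) * div_nonlin th z \<xi> \<partial>lborel))"

end

theory Submission
  imports Defs "HOL-Real_Asymp.Real_Asymp"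
begin

text \<open>Smallness in the Gevrey space with s < 1 gives smallness of the data in the scale-invariant
space of functions with integrable Fourier transform.  Put g(t,xi) = sup of exp(q |xi|/2) |hat theta(q,xi)|
over times q at most t.  Duhamel's formula and subadditivity of |xi| give
g(t) <= |hat theta_0| + C g(t) * g(t) pointwise.  The L^1 norm of g(t) depends continuously on t, so it
can never leave the small root of the resulting quadratic inequality; Young's inequality then bounds
g in L^2 by theta_0.  To have finite quantities from the start, the exponent is truncated at R, and low
frequencies are damped by min 1 (N |xi|); both truncations respect subadditivity and are removed
at the end.  Hence |hat theta(t,xi)| <= exp(-t |xi|/2) U(xi) with U in L^2.  Since 1/sigma < 1, the multiplier
(t |xi|)^(2 kappa) exp(2 a |xi|^(1/sigma) - t |xi|) is bounded for t >= 1 and tends to 0, and dominated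
convergence yields all the limits.\<close>

subsection \<open>Convolution on Euclidean space\<close>
lemma distr_lborel_reflect:
  fixes x :: "'a::euclidean_space"
  shows "distr lborel borel (\<lambda>y. x - y) = lborel"
  by (subst (2) lborel_affine[of "-1" x]) (auto simp: density_1)

lemma nn_integral_lborel_reflect:
  fixes x :: "'a::euclidean_space"
  assumes [measurable]: "f \<in> borel_measurable borel"
  shows "(\<integral>\<^sup>+y. f (x - y) \<partial>lborel) = (\<integral>\<^sup>+y. f y \<partial>lborel)"
proof -
  have "(\<integral>\<^sup>+y. f y \<partial>lborel) = (\<integral>\<^sup>+y. f y \<partial>distr lborel borel (\<lambda>y. x - y))"
    by (simp only: distr_lborel_reflect)
  also have "\<dots> = (\<integral>\<^sup>+y. f (x - y) \<partial>lborel)"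
    by (subst nn_integral_distr) auto
  finally show ?thesis by simp
qed

lemma nn_integral_lborel_reflect':
  fixes y :: "'a::euclidean_space"
  assumes [measurable]: "f \<in> borel_measurable borel"
  shows "(\<integral>\<^sup>+x. f (x - y) \<partial>lborel) = (\<integral>\<^sup>+x. f x \<partial>lborel)"
proof -
  have "(\<integral>\<^sup>+x. f x \<partial>lborel) = (\<integral>\<^sup>+x. f x \<partial>distr lborel borel ((+) (- y)))"
    by (simp only: lborel_distr_plus)
  also have "\<dots> = (\<integral>\<^sup>+x. f (x - y) \<partial>lborel)"
    by (subst nn_integral_distr) auto
  finally show ?thesis by simp
qed

lemma AE_lborel_reflect:
  fixes x :: "'a::euclidean_space"
  assumes "AE y in lborel. P y"
  shows "AE y in lborel. P (x - y)"
proof (rule AE_distrD[where f = "\<lambda>y. x - y" and M' = borel])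
  show "AE y in distr lborel borel (\<lambda>y. x - y). P y"
    unfolding distr_lborel_reflect by (rule assms)
qed simp

text \<open>Values in \<open>ennreal\<close> let Tonelli's theorem and Young's inequality apply to
  suprema whose finiteness is established only later.\<close>

definition nconv :: "('a::euclidean_space \<Rightarrow> ennreal) \<Rightarrow> ('a \<Rightarrow> ennreal) \<Rightarrow> 'a \<Rightarrow> ennreal" where
  "nconv f g x = (\<integral>\<^sup>+y. f (x - y) * g y \<partial>lborel)"

lemma borel_measurable_nconv [measurable]:
  assumes [measurable]: "f \<in> borel_measurable borel" "g \<in> borel_measurable borel"
  shows "nconv f g \<in> borel_measurable borel"
  unfolding nconv_def by measurable

lemma nconv_commute:
  assumes [measurable]: "f \<in> borel_measurable borel" "g \<in> borel_measurable borel"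
  shows "nconv f g x = nconv g f x"
  unfolding nconv_def
  using nn_integral_lborel_reflect[of "\<lambda>y. g (x - y) * f y" x] by (simp add: mult.commute)

lemma nn_integral_nconv:
  assumes [measurable]: "f \<in> borel_measurable borel" "g \<in> borel_measurable borel"
  shows "(\<integral>\<^sup>+x. nconv f g x \<partial>lborel) = (\<integral>\<^sup>+x. f x \<partial>lborel) * (\<integral>\<^sup>+x. g x \<partial>lborel)"
proof -
  have "(\<integral>\<^sup>+x. nconv f g x \<partial>lborel) = (\<integral>\<^sup>+y. \<integral>\<^sup>+x. f (x - y) * g y \<partial>lborel \<partial>lborel)"
    unfolding nconv_def by (rule lborel_pair.Fubini') measurable
  also have "\<dots> = (\<integral>\<^sup>+y. (\<integral>\<^sup>+x. f x \<partial>lborel) * g y \<partial>lborel)"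
    by (simp add: nn_integral_multc nn_integral_lborel_reflect')
  also have "\<dots> = (\<integral>\<^sup>+x. f x \<partial>lborel) * (\<integral>\<^sup>+x. g x \<partial>lborel)"
    by (simp add: nn_integral_cmult)
  finally show ?thesis .
qed

text \<open>Cauchy-Schwarz for the measure with density \<open>f (x - y)\<close>: the integrand is
  read as \<open>1 * g y\<close>, and reflection gives the total mass.\<close>

lemma power2_nconv_le:
  assumes [measurable]: "f \<in> borel_measurable borel" "g \<in> borel_measurable borel"
  shows "(nconv f g x)\<^sup>2 \<le> (\<integral>\<^sup>+y. f y \<partial>lborel) * nconv f (\<lambda>y. (g y)\<^sup>2) x"
proof -
  let ?M = "density lborel (\<lambda>y. f (x - y))"
  have "(nconv f g x)\<^sup>2 = (\<integral>\<^sup>+y. 1 * g y \<partial>?M)\<^sup>2"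
    unfolding nconv_def by (subst nn_integral_density) auto
  also have "\<dots> \<le> (\<integral>\<^sup>+y. 1\<^sup>2 \<partial>?M) * (\<integral>\<^sup>+y. (g y)\<^sup>2 \<partial>?M)"
    by (rule Cauchy_Schwarz_nn_integral) auto
  also have "(\<integral>\<^sup>+y. (g y)\<^sup>2 \<partial>?M) = nconv f (\<lambda>y. (g y)\<^sup>2) x"
    unfolding nconv_def by (subst nn_integral_density) auto
  also have "(\<integral>\<^sup>+y. 1\<^sup>2 \<partial>?M) = (\<integral>\<^sup>+y. f y \<partial>lborel)"
    by (subst nn_integral_density) (auto simp: nn_integral_lborel_reflect)
  finally show ?thesis .
qed

text \<open>Integrating the pointwise bound and applying Tonelli gives Young's inequality for a
  factor in L^1 and a factor in L^2.\<close>

lemma nn_integral_power2_nconv_le: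
  assumes [measurable]: "f \<in> borel_measurable borel" "g \<in> borel_measurable borel"
  shows "(\<integral>\<^sup>+x. (nconv f g x)\<^sup>2 \<partial>lborel) \<le> (\<integral>\<^sup>+x. f x \<partial>lborel)\<^sup>2 * (\<integral>\<^sup>+x. (g x)\<^sup>2 \<partial>lborel)"
proof -
  have "(\<integral>\<^sup>+x. (nconv f g x)\<^sup>2 \<partial>lborel)
      \<le> (\<integral>\<^sup>+x. (\<integral>\<^sup>+y. f y \<partial>lborel) * nconv f (\<lambda>y. (g y)\<^sup>2) x \<partial>lborel)"
    by (intro nn_integral_mono power2_nconv_le) auto
  also have "\<dots> = (\<integral>\<^sup>+x. f x \<partial>lborel)\<^sup>2 * (\<integral>\<^sup>+x. (g x)\<^sup>2 \<partial>lborel)"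
    by (simp add: nn_integral_cmult nn_integral_nconv power2_eq_square mult.assoc)
  finally show ?thesis .
qed

section \<open>Time integrals and integrability of the reciprocal Gevrey weight\<close>

text \<open>The factor \<open>r\<close> is the frequency lost to the divergence; integrating half of
  the dissipation in time recovers it, uniformly in \<open>r\<close> and \<open>t\<close>.\<close>

lemma nn_integral_exp_Icc_le:
  fixes r t :: real
  assumes "r \<ge> 0" "t \<ge> 0"
  shows "(\<integral>\<^sup>+z. ennreal (r * exp (- (t - z) * r / 2)) * indicator {0..t} z \<partial>lborel) \<le> 2"
proof -
  have "(\<integral>\<^sup>+z. ennreal (r * exp (- (t - z) * r / 2)) * indicator {0..t} z \<partial>lborel)
      = ennreal (2 * exp (- (t - t) * r / 2) - 2 * exp (- (t - 0) * r / 2))"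
    using assms by (intro nn_integral_FTC_Icc) (auto intro!: derivative_eq_intros)
  also have "\<dots> \<le> 2" by (simp add: ennreal_le_iff flip: ennreal_numeral)
  finally show ?thesis .
qed

lemma bounded_above_atLeast:
  fixes f :: "real \<Rightarrow> real"
  assumes "continuous_on {c..} f" "\<forall>\<^sub>F x in at_top. f x \<le> K"
  shows "\<exists>B. \<forall>x\<ge>c. f x \<le> B"
proof -
  obtain N where N: "\<And>x. x \<ge> N \<Longrightarrow> f x \<le> K"
    using assms(2) by (auto simp: eventually_at_top_linorder)
  have "bounded (f ` {c..max c N})"
    using assms(1) by (intro compact_imp_bounded compact_continuous_image) (auto elim: continuous_on_subset)
  then obtain B where "\<forall>y\<in>f ` {c..max c N}. norm y \<le> B"
    unfolding bounded_iff by blast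
  then have B: "f x \<le> B" if "x \<in> {c..max c N}" for x
    using that by force
  have "f x \<le> max K B" if "x \<ge> c" for x
    using B[of x] N[of x] that by (cases "x \<le> max c N") (force simp: le_max_iff_disj)+
  then show ?thesis by blast
qed

lemma exists_bound_powr_exp:
  fixes a b s :: real
  assumes "a > 0" "b > 0"
  shows "\<exists>C. \<forall>x\<ge>1. x powr (- s) * exp (- a * x powr b) \<le> C * (1 / x\<^sup>2)"
proof -
  \<comment> \<open>Two extra powers of \<open>x\<close> are spent to reach the majorant
    \<open>1 / x\<^sup>2\<close>, which is integrable at infinity.\<close>
  have "((\<lambda>x. x powr (2 - s) * exp (- a * x powr b)) \<longlongrightarrow> 0) at_top"
    using assms by real_asymp
  then have "\<forall>\<^sub>F x in at_top. x powr (2 - s) * exp (- a * x powr b) < 1"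
    by (rule order_tendstoD) simp
  then have "\<forall>\<^sub>F x in at_top. x powr (2 - s) * exp (- a * x powr b) \<le> 1"
    by (rule eventually_mono) simp
  then have "\<exists>B. \<forall>x\<ge>1. x powr (2 - s) * exp (- a * x powr b) \<le> B"
    by (intro bounded_above_atLeast) (auto intro!: continuous_intros)
  then obtain B where B: "\<And>x. x \<ge> 1 \<Longrightarrow> x powr (2 - s) * exp (- a * x powr b) \<le> B" by blast
  have "x powr (- s) * exp (- a * x powr b) \<le> B * (1 / x\<^sup>2)" if "x \<ge> 1" for x
  proof -
    have "x powr (2 - s) = x\<^sup>2 * x powr (- s)"
      using that by (simp add: powr_diff powr_minus_divide powr_numeral)
    then show ?thesis
      using B[OF that] that by (simp add: field_simps)
  qed
  then show ?thesis by blast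
qed

lemma nn_integral_even:
  fixes f :: "real \<Rightarrow> ennreal"
  assumes [measurable]: "f \<in> borel_measurable borel" and even: "\<And>x. f (- x) = f x"
  shows "(\<integral>\<^sup>+x. f x \<partial>lborel) \<le> 2 * (\<integral>\<^sup>+x. f x * indicator {0..} x \<partial>lborel)"
proof -
  have "(\<integral>\<^sup>+x. f x \<partial>lborel) \<le> (\<integral>\<^sup>+x. f x * indicator {0..} x + f (0 - x) * indicator {0..} (0 - x) \<partial>lborel)"
    by (intro nn_integral_mono) (auto simp: indicator_def even)
  also have "\<dots> = (\<integral>\<^sup>+x. f x * indicator {0..} x \<partial>lborel) + (\<integral>\<^sup>+x. f (0 - x) * indicator {0..} (0 - x) \<partial>lborel)"
    by (rule nn_integral_add) measurable
  also have "(\<integral>\<^sup>+x. f (0 - x) * indicator {0..} (0 - x) \<partial>lborel) = (\<integral>\<^sup>+x. f x * indicator {0..} x \<partial>lborel)"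
    by (rule nn_integral_lborel_reflect[where f = "\<lambda>x. f x * indicator {0..} x"]) measurable
  finally show ?thesis by (simp add: mult_2)
qed

lemma nn_integral_powr_exp_real_finite:
  fixes a b s :: real
  assumes "a > 0" "b > 0" "s < 1"
  shows "(\<integral>\<^sup>+x. ennreal (\<bar>x\<bar> powr (- s) * exp (- a * \<bar>x\<bar> powr b)) \<partial>lborel) < \<infinity>"
proof -
  let ?f = "\<lambda>x::real. \<bar>x\<bar> powr (- s) * exp (- a * \<bar>x\<bar> powr b)"
  obtain C where C: "\<And>x. x \<ge> 1 \<Longrightarrow> x powr (- s) * exp (- a * x powr b) \<le> C * (1 / x\<^sup>2)"
    using exists_bound_powr_exp[OF assms(1,2), of s] by blast
  \<comment> \<open>At \<open>x = 1\<close> the left-hand side is \<open>exp (- a)\<close>, which is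
    positive.\<close>
  have C0: "C \<ge> 0" using C[of 1] by (simp add: order_trans[OF exp_ge_zero])
  have fin1: "(\<integral>\<^sup>+x. ennreal (x powr (- s)) * indicator {0..1} x \<partial>lborel) < \<infinity>"
  proof -
    have "((\<lambda>x. x powr (- s)) has_integral (1 powr (- s + 1) / (- s + 1))) {0..1::real}"
      using assms by (intro has_integral_powr_from_0) auto
    then have "(\<integral>\<^sup>+x. ennreal (x powr (- s)) * indicator {0..1} x \<partial>lborel) = ennreal (1 powr (- s + 1) / (- s + 1))"
      by (subst nn_integral_has_integral_lebesgue') auto
    then show ?thesis by simp
  qed
  have fin2: "(\<integral>\<^sup>+x. ennreal (C * (1 / x\<^sup>2)) * indicator {1..} x \<partial>lborel) < \<infinity>"
  proof -
    have "(\<integral>\<^sup>+x. ennreal (C * (1 / x\<^sup>2)) * indicator {1..} x \<partial>lborel) = ennreal (0 - (- C / 1))"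
      using C0 by (intro nn_integral_FTC_atLeast[where F = "\<lambda>x. - C / x"])
        (auto intro!: derivative_eq_intros simp: power2_eq_square, real_asymp)
    then show ?thesis by simp
  qed
  have "(\<integral>\<^sup>+x. ennreal (?f x) \<partial>lborel) \<le> 2 * (\<integral>\<^sup>+x. ennreal (?f x) * indicator {0..} x \<partial>lborel)"
    by (rule nn_integral_even) auto
  also have "(\<integral>\<^sup>+x. ennreal (?f x) * indicator {0..} x \<partial>lborel)
    \<le> (\<integral>\<^sup>+x. ennreal (x powr (- s)) * indicator {0..1} x + ennreal (C * (1 / x\<^sup>2)) * indicator {1..} x \<partial>lborel)"
  proof (rule nn_integral_mono)
    fix x :: real
    consider "x < 0" | "0 \<le> x" "x < 1" | "x \<ge> 1" by linarith
    then show "ennreal (?f x) * indicator {0..} x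
        \<le> ennreal (x powr (- s)) * indicator {0..1} x + ennreal (C * (1 / x\<^sup>2)) * indicator {1..} x"
    proof cases
      case 2
      have "?f x \<le> x powr (- s) * 1"
        using 2 assms by (intro mult_mono) auto
      then show ?thesis using 2 by (auto intro: ennreal_leI)
    next
      case 3
      then have "ennreal (?f x) \<le> ennreal (C * (1 / x\<^sup>2))" using C[of x] by (intro ennreal_leI) simp
      then show ?thesis using 3 by (auto simp: add_increasing)
    qed auto
  qed
  also have "\<dots> = (\<integral>\<^sup>+x. ennreal (x powr (- s)) * indicator {0..1} x \<partial>lborel)
      + (\<integral>\<^sup>+x. ennreal (C * (1 / x\<^sup>2)) * indicator {1..} x \<partial>lborel)"
    by (rule nn_integral_add) measurable
  finally have "(\<integral>\<^sup>+x. ennreal (?f x) \<partial>lborel)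
      \<le> 2 * ((\<integral>\<^sup>+x. ennreal (x powr (- s)) * indicator {0..1} x \<partial>lborel)
        + (\<integral>\<^sup>+x. ennreal (C * (1 / x\<^sup>2)) * indicator {1..} x \<partial>lborel))"
    by (simp add: mult_left_mono)
  also have "\<dots> < \<infinity>" using fin1 fin2 by (auto simp: ennreal_mult_less_top)
  finally show ?thesis .
qed

text \<open>The norm dominates both coordinates and the radial profile decreases, so each coordinate
  receives half of both exponents. Tonelli then reduces the claim to the line, where the singularity
  is integrable because \<open>s < 1\<close>.\<close>

lemma nn_integral_powr_exp_plane_finite:
  fixes a b s :: real
  assumes "a > 0" "b > 0" "0 \<le> s" "s < 1"
  shows "(\<integral>\<^sup>+\<xi>. ennreal (norm \<xi> powr (- (2 * s)) * exp (- 2 * a * norm \<xi> powr b)) \<partial>(lborel :: (real^2) measure)) < \<infinity>"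
proof -
  let ?f = "\<lambda>x::real. \<bar>x\<bar> powr (- s) * exp (- a * \<bar>x\<bar> powr b)"
  have b2: "\<exists>u v. (Basis :: (real^2) set) = {u, v} \<and> u \<noteq> v"
    by (intro exI[of _ "axis 1 1"] exI[of _ "axis 2 1"])
      (auto simp: Basis_vec_def axis_eq_axis exhaust_2 UNIV_2)
  \<comment> \<open>On the axes the comparison breaks down: \<open>0 powr (- s)\<close> is 0 by
    convention, so the product on the right vanishes there.\<close>
  have AE0: "AE \<xi> in (lborel :: (real^2) measure). \<forall>b\<in>Basis. \<xi> \<bullet> b \<noteq> 0"
    by (subst AE_finite_all) (auto intro: AE_lborel_inner_neq)
  have "(\<integral>\<^sup>+\<xi>. ennreal (norm \<xi> powr (- (2 * s)) * exp (- 2 * a * norm \<xi> powr b)) \<partial>(lborel :: (real^2) measure))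
     \<le> (\<integral>\<^sup>+\<xi>. (\<Prod>b\<in>Basis. ennreal (?f (\<xi> \<bullet> b))) \<partial>(lborel :: (real^2) measure))"
  proof (rule nn_integral_mono_AE, use AE0 in eventually_elim)
    case (elim \<xi>)
    obtain u v :: "real^2" where uv: "Basis = {u, v}" "u \<noteq> v" using b2 by blast
    define r where "r = norm \<xi>"
    define x where "x = \<bar>\<xi> \<bullet> u\<bar>"
    define y where "y = \<bar>\<xi> \<bullet> v\<bar>"
    have xy: "0 < x" "x \<le> r" "0 < y" "y \<le> r"
      using elim uv Basis_le_norm[of u \<xi>] Basis_le_norm[of v \<xi>] by (auto simp: x_def y_def r_def)
    have "r powr (- (2 * s)) * exp (- 2 * a * r powr b)
        = (r powr (- s) * exp (- a * r powr b)) * (r powr (- s) * exp (- a * r powr b))"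
      using xy by (simp add: algebra_simps flip: powr_add exp_add)
    also have "\<dots> \<le> (x powr (- s) * exp (- a * x powr b)) * (y powr (- s) * exp (- a * y powr b))"
    proof -
      have "r powr (- s) * exp (- a * r powr b) \<le> z powr (- s) * exp (- a * z powr b)"
        if "0 < z" "z \<le> r" for z
        using that assms powr_mono2[of b z r] powr_mono2'[of "- s" z r] by (intro mult_mono) auto
      then show ?thesis using xy by (intro mult_mono[OF _ _ mult_nonneg_nonneg mult_nonneg_nonneg]) auto
    qed
    finally have "r powr (- (2 * s)) * exp (- 2 * a * r powr b) \<le> ?f (\<xi> \<bullet> u) * ?f (\<xi> \<bullet> v)"
      by (simp add: x_def y_def)
    moreover have "(\<Prod>b\<in>Basis. ennreal (?f (\<xi> \<bullet> b))) = ennreal (?f (\<xi> \<bullet> u) * ?f (\<xi> \<bullet> v))"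
      unfolding uv(1) using uv(2) by (simp add: ennreal_mult)
    ultimately show ?case by (simp add: r_def ennreal_leI)
  qed
  also have "\<dots> = (\<Prod>b\<in>(Basis :: (real^2) set). (\<integral>\<^sup>+x. ennreal (?f x) \<partial>lborel))"
    by (rule nn_integral_lborel_prod) auto
  also have "\<dots> < \<infinity>"
    using nn_integral_powr_exp_real_finite[OF assms(1,2,4)]
    by (simp add: power_less_top_ennreal)
  finally show ?thesis .
qed

subsection \<open>Running suprema\<close>

text \<open>The supremum is restricted to rational times so that it is measurable in the frequency variable
and only countably many null sets occur.\<close>
definition rat_sup :: "(real \<Rightarrow> ennreal) \<Rightarrow> real \<Rightarrow> ennreal" where
  "rat_sup f T = (SUP q\<in>\<rat> \<inter> {0..T}. f q)"

text \<open>Otherwise, by continuity, \<open>f\<close> would exceed the supremum at rational times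
  slightly below \<open>t\<close>, which still lie in \<open>{0..T}\<close>.\<close>

lemma le_rat_sup:
  assumes cont: "continuous_on {0..} f" and t: "0 \<le> t" "t \<le> T"
  shows "f t \<le> rat_sup f T"
proof (cases "t \<in> \<rat>")
  case True
  then show ?thesis unfolding rat_sup_def using t by (intro SUP_upper) auto
next
  case False
  then have "t > 0" using t by (metis Rats_0 order_le_less)
  show ?thesis
  proof (rule ccontr)
    assume "\<not> ?thesis"
    then have less: "rat_sup f T < f t" by simp
    have "(f \<longlongrightarrow> f t) (at t within {0..})"
      using cont t by (auto simp: continuous_on_def)
    from order_tendstoD(1)[OF this less]
    obtain d where d: "d > 0" "\<And>x. x \<ge> 0 \<Longrightarrow> x \<noteq> t \<Longrightarrow> dist x t < d \<Longrightarrow> rat_sup f T < f x"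
      unfolding eventually_at by auto
    obtain q where q: "q \<in> \<rat>" "max 0 (t - d) < q" "q < t"
      using Rats_dense_in_real[of "max 0 (t - d)" t] \<open>t > 0\<close> d(1) by auto
    then have "rat_sup f T < f q" by (intro d) (auto simp: dist_real_def)
    moreover have "f q \<le> rat_sup f T"
      unfolding rat_sup_def using q t by (intro SUP_upper) auto
    ultimately show False by simp
  qed
qed

text \<open>Between nearby horizons the supremum gains only values of \<open>f\<close> at nearby
  times, and these are close to \<open>f T0\<close>, which the supremum at \<open>T0\<close> already
  dominates.\<close>

lemma continuous_on_rat_sup:
  assumes cont: "continuous_on {0..} f"
  shows "continuous_on {0..} (rat_sup f)"
  unfolding continuous_on_def
proof (intro ballI order_tendstoI)
  fix T0 :: real and a assume T0: "T0 \<in> {0..}"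
  have lim: "(f \<longlongrightarrow> f T0) (at T0 within {0..})"
    using cont T0 by (auto simp: continuous_on_def)
  {
    assume "a < rat_sup f T0"
    then obtain q where q: "q \<in> \<rat>" "0 \<le> q" "q \<le> T0" "a < f q"
      by (auto simp: rat_sup_def less_SUP_iff)
    show "\<forall>\<^sub>F T in at T0 within {0..}. a < rat_sup f T"
    \<comment> \<open>A witness \<open>q < T0\<close> stays admissible for all \<open>T\<close> near
      \<open>T0\<close>. The witness \<open>q = T0\<close> may drop out, and then \<open>f T\<close>
      replaces it.\<close>
    proof (cases "q = T0")
      case True
      have "\<forall>\<^sub>F T in at T0 within {0..}. a < f T"
        using order_tendstoD(1)[OF lim] q True by auto
      moreover have "\<forall>\<^sub>F T in at T0 within {0..}. T \<in> {0..}"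
        by (simp add: eventually_at_filter)
      ultimately show ?thesis
        by eventually_elim (use le_rat_sup[OF cont] in \<open>auto intro: less_le_trans\<close>)
    next
      case False
      then have "\<forall>\<^sub>F T in at T0 within {0..}. q < T"
        using q by (intro order_tendstoD(1)[of "\<lambda>T. T" T0]) auto
      then show ?thesis
      proof eventually_elim
        case (elim T)
        have "f q \<le> rat_sup f T"
          unfolding rat_sup_def using q elim by (intro SUP_upper) auto
        then show ?case using q by (auto intro: less_le_trans)
      qed
    qed
  }
  {
    assume "rat_sup f T0 < a"
    \<comment> \<open>Strict pointwise bounds survive a supremum only as weak ones, hence the
      intermediate value \<open>a'\<close>.\<close>
    then obtain a' where a': "rat_sup f T0 < a'" "a' < a" using dense by blast
    have "f T0 < a'" using le_rat_sup[OF cont, of T0 T0] T0 a' by auto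
    from order_tendstoD(2)[OF lim this]
    obtain d where d: "d > 0" "\<And>x. x \<ge> 0 \<Longrightarrow> x \<noteq> T0 \<Longrightarrow> dist x T0 < d \<Longrightarrow> f x < a'"
      unfolding eventually_at by auto
    have "rat_sup f T < a" if "dist T T0 < d" for T
    proof -
      have "f q \<le> a'" if q: "q \<in> \<rat> \<inter> {0..T}" for q
      proof (cases "q \<le> T0")
        case True
        then have "f q \<le> rat_sup f T0"
          unfolding rat_sup_def using q by (intro SUP_upper) auto
        then show ?thesis using a' by simp
      next
        case False
        then show ?thesis
          using q T0 \<open>dist T T0 < d\<close> by (intro less_imp_le d) (auto simp: dist_real_def)
      qed
      then have "rat_sup f T \<le> a'" unfolding rat_sup_def by (rule SUP_least)
      then show ?thesis using a' by simp
    qed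
    then show "\<forall>\<^sub>F T in at T0 within {0..}. rat_sup f T < a"
      unfolding eventually_at using d(1) by auto
  }
qed

section \<open>Squares, suprema and norms in the extended nonnegative reals\<close>

lemma power2_ennsqrt: "(ennsqrt x)\<^sup>2 = x"
  by (cases x) (auto simp: ennsqrt_def ennreal_power)

lemma ennreal_power2_le_cancel:
  fixes x y :: ennreal
  assumes "x\<^sup>2 \<le> y\<^sup>2" shows "x \<le> y"
proof (cases x; cases y)
  fix u v :: real assume "0 \<le> u" "x = ennreal u" "0 \<le> v" "y = ennreal v"
  then show ?thesis using assms by (simp add: ennreal_power)
next
  fix v :: real assume "x = top" "0 \<le> v" "y = ennreal v"
  then show ?thesis using assms by (simp add: ennreal_power top_power_ennreal top_unique)
qed auto

lemma tendsto_zero_if_power2_tendsto_zero: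
  fixes f :: "'a \<Rightarrow> ennreal"
  assumes "((\<lambda>x. (f x)\<^sup>2) \<longlongrightarrow> 0) F"
  shows "(f \<longlongrightarrow> 0) F"
proof (rule order_tendstoI)
  fix a :: ennreal assume "0 < a"
  then have "0 < a\<^sup>2" by (simp add: power2_eq_square ennreal_zero_less_mult_iff)
  from order_tendstoD(2)[OF assms this] show "\<forall>\<^sub>F x in F. f x < a"
  proof eventually_elim
    case (elim x)
    then show ?case using power_mono[of a "f x" 2] by (auto simp: not_less[symmetric])
  qed
qed auto

lemma power2_add_le_ennreal:
  fixes x y :: ennreal
  shows "(x + y)\<^sup>2 \<le> 2 * x\<^sup>2 + 2 * y\<^sup>2"
proof (cases x; cases y)
  fix u v :: real assume uv: "0 \<le> u" "x = ennreal u" "0 \<le> v" "y = ennreal v"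
  have "(u + v)\<^sup>2 \<le> 2 * u\<^sup>2 + 2 * v\<^sup>2"
    using zero_le_power2[of "u - v"] by (simp add: power2_eq_square algebra_simps)
  then have "ennreal ((u + v)\<^sup>2) \<le> ennreal (2 * u\<^sup>2 + 2 * v\<^sup>2)" by (rule ennreal_leI)
  also have "\<dots> = 2 * x\<^sup>2 + 2 * y\<^sup>2"
    using uv by (simp add: ennreal_power ennreal_mult'')
  finally show ?thesis using uv by (simp add: ennreal_power flip: ennreal_plus)
qed auto

text \<open>By default a nonintegrable function has Bochner integral 0, so only the integrable case
  has content.\<close>

lemma norm_integral_le_nn_integral:
  fixes f :: "'a \<Rightarrow> 'b::{banach, second_countable_topology}"
  shows "ennreal (norm (\<integral>x. f x \<partial>M)) \<le> (\<integral>\<^sup>+x. ennreal (norm (f x)) \<partial>M)"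
  by (cases "integrable M f") (auto intro: integral_norm_bound_ennreal simp: not_integrable_integral_eq)

lemma SUP_power2_le_ennreal:
  fixes f :: "'i \<Rightarrow> ennreal"
  shows "(SUP i\<in>I. f i)\<^sup>2 \<le> (SUP i\<in>I. (f i)\<^sup>2)"
proof -
  let ?S = "SUP i\<in>I. (f i)\<^sup>2"
  have "f i \<le> ennsqrt ?S" if "i \<in> I" for i
    by (rule ennreal_power2_le_cancel) (unfold power2_ennsqrt, rule SUP_upper[OF that])
  then have "(SUP i\<in>I. f i) \<le> ennsqrt ?S" by (rule SUP_least)
  then have "(SUP i\<in>I. f i)\<^sup>2 \<le> (ennsqrt ?S)\<^sup>2" by (rule power_mono) simp
  then show ?thesis by (simp add: power2_ennsqrt)
qed

section \<open>Bounds for the kernel and for the decay multiplier\<close>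

text \<open>Lagrange's identity: the squares of the determinant and of the inner product add up to
  \<open>(norm \<xi> * norm \<eta>)\<^sup>2\<close>. For \<open>\<eta> = 0\<close> division by zero
  makes the kernel 0.\<close>

lemma qg_kernel_le: "\<bar>qg_kernel \<xi> \<eta>\<bar> \<le> norm \<xi>"
proof (cases "\<eta> = 0")
  case False
  have n: "(norm x)\<^sup>2 = (x $ 1)\<^sup>2 + (x $ 2)\<^sup>2" for x :: "real^2"
    unfolding power2_norm_eq_inner inner_vec_def sum_2 inner_real_def by (simp add: power2_eq_square)
  have "\<bar>\<xi>$1 * \<eta>$2 - \<xi>$2 * \<eta>$1\<bar> \<le> norm \<xi> * norm \<eta>"
  proof (rule power2_le_imp_le)
    show "\<bar>\<xi>$1 * \<eta>$2 - \<xi>$2 * \<eta>$1\<bar>\<^sup>2 \<le> (norm \<xi> * norm \<eta>)\<^sup>2"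
      unfolding power_mult_distrib n power2_abs
      using zero_le_power2[of "\<xi>$1 * \<eta>$1 + \<xi>$2 * \<eta>$2"]
      by (simp add: power2_eq_square algebra_simps)
  qed simp
  then show ?thesis using False by (simp add: qg_kernel_def field_simps)
qed (simp add: qg_kernel_def)

text \<open>One half of the decay \<open>exp (- t * r)\<close> controls the power, as a function of
  \<open>t * r\<close> alone. The other half controls \<open>p * r powr b\<close>: since
  \<open>t \<ge> 1\<close>, it is at most \<open>exp (- r / 2)\<close>, and
  \<open>b < 1\<close>.\<close>

lemma decay_multiplier_bounded:
  fixes p b k :: real
  assumes "p \<ge> 0" "0 < b" "b < 1" "k \<ge> 0"
  shows "\<exists>B. \<forall>r\<ge>0. \<forall>t\<ge>1. (t * r) powr k * exp (p * r powr b - t * r) \<le> B"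
proof -
  have "\<forall>\<^sub>F x in at_top. x powr k * exp (- x / 2) \<le> 1" by real_asymp
  then have "\<exists>B. \<forall>x\<ge>1. x powr k * exp (- x / 2) \<le> B"
    by (intro bounded_above_atLeast) (auto intro!: continuous_intros)
  then obtain B1 where B1: "\<And>x. x \<ge> 1 \<Longrightarrow> x powr k * exp (- x / 2) \<le> B1" by blast
  have B1': "x powr k * exp (- x / 2) \<le> max 1 B1" if "x \<ge> 0" for x
  proof (cases "x \<ge> 1")
    case False
    then have "x powr k * exp (- x / 2) \<le> 1 * 1"
      using that assms by (intro mult_mono powr_le1) auto
    then show ?thesis by simp
  qed (use B1[of x] in simp)
  have "\<forall>\<^sub>F x in at_top. p * x powr b - x / 2 \<le> 1" using assms by real_asymp
  then have "\<exists>B. \<forall>x\<ge>1. p * x powr b - x / 2 \<le> B"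
    by (intro bounded_above_atLeast) (auto intro!: continuous_intros)
  then obtain B2 where B2: "\<And>x. x \<ge> 1 \<Longrightarrow> p * x powr b - x / 2 \<le> B2" by blast
  have B2': "p * x powr b - x / 2 \<le> max p B2" if "x \<ge> 0" for x
  proof (cases "x \<ge> 1")
    case False
    then have "p * x powr b \<le> p * 1"
      using that assms by (intro mult_left_mono powr_le1) auto
    then show ?thesis using that by simp
  qed (use B2[of x] in simp)
  have "(t * r) powr k * exp (p * r powr b - t * r) \<le> max 1 B1 * exp (max p B2)"
    if "r \<ge> 0" "t \<ge> 1" for r t
  proof -
    have "(t * r) powr k * exp (p * r powr b - t * r)
        = ((t * r) powr k * exp (- (t * r) / 2)) * exp (p * r powr b - t * r / 2)"
      by (simp flip: exp_add)
    also have "\<dots> \<le> max 1 B1 * exp (max p B2)"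
    proof (intro mult_mono B1')
      have "r \<le> t * r" using that mult_right_mono[of 1 t r] by simp
      then show "exp (p * r powr b - t * r / 2) \<le> exp (max p B2)"
        using B2'[of r] that by simp
    qed (use that in auto)
    finally show ?thesis .
  qed
  then show ?thesis by blast
qed

lemma decay_multiplier_tendsto_0:
  fixes p b k r :: real
  assumes "r > 0"
  shows "((\<lambda>t. (t * r) powr k * exp (p * r powr b - t * r)) \<longlongrightarrow> 0) at_top"
proof -
  \<comment> \<open>For fixed \<open>r\<close> the Gevrey exponent does not depend on
    \<open>t\<close>.\<close>
  define c where "c = p * r powr b"
  show ?thesis unfolding c_def[symmetric] using assms by real_asymp
qed

section \<open>Embedding of the Gevrey space into functions with integrable Fourier
  transform\<close>

text \<open>This is the integral of the reciprocal of \<open>gev_weight a \<sigma> s\<close>, the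
  squared constant of the embedding.\<close>

definition gev_recip :: "real \<Rightarrow> real \<Rightarrow> real \<Rightarrow> ennreal" where
  "gev_recip a \<sigma> s = (\<integral>\<^sup>+\<xi>. ennreal (norm \<xi> powr (- (2 * s)) * exp (- 2 * a * norm \<xi> powr (1 / \<sigma>)))
     \<partial>(lborel :: (real^2) measure))"

lemma borel_measurable_gev_weight [measurable]: "gev_weight a \<sigma> \<kappa> \<in> borel_measurable borel"
  unfolding gev_weight_def by measurable

lemma AE_lborel_nonzero: "AE \<xi> in (lborel :: (real^2) measure). \<xi> \<noteq> 0"
  by (rule AE_lborel_singleton)

text \<open>Cauchy-Schwarz after multiplying and dividing by the square root of the weight.\<close>

lemma power2_nn_integral_le_gev:
  assumes [measurable]: "f \<in> borel_measurable borel"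
  shows "(\<integral>\<^sup>+\<xi>. f \<xi> \<partial>lborel)\<^sup>2
    \<le> (\<integral>\<^sup>+\<xi>. ennreal (gev_weight a \<sigma> s \<xi>) * (f \<xi>)\<^sup>2 \<partial>lborel) * gev_recip a \<sigma> s"
proof -
  let ?w = "gev_weight a \<sigma> s"
  have pos: "?w \<xi> > 0" if "\<xi> \<noteq> 0" for \<xi> using that by (simp add: gev_weight_def)
  have "(\<integral>\<^sup>+\<xi>. f \<xi> \<partial>lborel) = (\<integral>\<^sup>+\<xi>. (ennreal (sqrt (?w \<xi>)) * f \<xi>) * ennreal (1 / sqrt (?w \<xi>)) \<partial>lborel)"
  \<comment> \<open>The weight vanishes at frequency 0, so dividing by it makes sense only off that
    null set.\<close>
  proof (rule nn_integral_cong_AE, use AE_lborel_nonzero in eventually_elim)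
    case (elim \<xi>)
    have "(ennreal (sqrt (?w \<xi>)) * f \<xi>) * ennreal (1 / sqrt (?w \<xi>))
        = ennreal (sqrt (?w \<xi>) * (1 / sqrt (?w \<xi>))) * f \<xi>"
      using pos[OF elim] by (subst ennreal_mult) (auto simp: mult_ac)
    also have "sqrt (?w \<xi>) * (1 / sqrt (?w \<xi>)) = 1" using pos[OF elim] by simp
    finally show ?case by simp
  qed
  also have "\<dots>\<^sup>2 \<le> (\<integral>\<^sup>+\<xi>. (ennreal (sqrt (?w \<xi>)) * f \<xi>)\<^sup>2 \<partial>lborel)
      * (\<integral>\<^sup>+\<xi>. (ennreal (1 / sqrt (?w \<xi>)))\<^sup>2 \<partial>lborel)"
    by (rule Cauchy_Schwarz_nn_integral) auto
  also have "(\<integral>\<^sup>+\<xi>. (ennreal (sqrt (?w \<xi>)) * f \<xi>)\<^sup>2 \<partial>lborel)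
      = (\<integral>\<^sup>+\<xi>. ennreal (?w \<xi>) * (f \<xi>)\<^sup>2 \<partial>lborel)"
    by (intro nn_integral_cong) (simp add: power_mult_distrib ennreal_power gev_weight_def)
  also have "(\<integral>\<^sup>+\<xi>. (ennreal (1 / sqrt (?w \<xi>)))\<^sup>2 \<partial>lborel) = gev_recip a \<sigma> s"
    unfolding gev_recip_def
    by (intro nn_integral_cong)
      (simp add: ennreal_power power_divide gev_weight_def powr_minus exp_minus field_simps)
  finally show ?thesis .
qed

lemma of_real_exp_mult_exp:
  "complex_of_real (exp u) * (complex_of_real (exp v) * x) = complex_of_real (exp (u + v)) * x"
  by (simp add: exp_add)

text \<open>Half of \<open>x\<close> may be subtracted on both sides only when \<open>x\<close> is
  finite; for infinite \<open>x\<close> the first inequality carries no information.\<close>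

lemma ennreal_le_double_of_le_add_half:
  fixes x A :: ennreal
  assumes "x \<le> A + ennreal (1 / 2) * x" "x < \<infinity>"
  shows "x \<le> 2 * A"
proof (cases A)
  case (real u)
  obtain v where v: "0 \<le> v" "x = ennreal v" using assms(2) by (cases x) auto
  have "ennreal v \<le> ennreal (u + 1 / 2 * v)"
  proof -
    have "ennreal (u + 1 / 2 * v) = ennreal u + ennreal (1 / 2) * ennreal v"
      using real v by (subst ennreal_plus, simp, simp, subst ennreal_mult, simp_all)
    then show ?thesis using assms(1) unfolding real(2) v(2) by (simp only:)
  qed
  then have "v \<le> 2 * u" using real v by (subst (asm) ennreal_le_iff) auto
  then show ?thesis using real v by (simp add: ennreal_leI flip: ennreal_numeral ennreal_mult)
qed (simp add: ennreal_mult_top)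

subsection \<open>The low-frequency cutoff\<close>

text \<open>Linear vanishing at frequency 0 makes the factor there at most a multiple of
  \<open>norm \<xi> powr s\<close> for \<open>s < 1\<close>; at every other frequency it increases
  to 1 with \<open>N\<close>.\<close>

definition low_cut :: "nat \<Rightarrow> real^2 \<Rightarrow> real" where
  "low_cut N \<xi> = min 1 (real N * norm \<xi>)"

lemma borel_measurable_low_cut [measurable]: "low_cut N \<in> borel_measurable borel"
  unfolding low_cut_def by measurable

lemma low_cut_bounds: "0 \<le> low_cut N \<xi>" "low_cut N \<xi> \<le> 1"
  by (auto simp: low_cut_def)

text \<open>The triangle inequality survives truncation at 1 because both summands are nonnegative.
  This lets the cutoff pass to either factor of a convolution.\<close>

lemma low_cut_subadditive: "low_cut N \<xi> \<le> low_cut N (\<xi> - \<eta>) + low_cut N \<eta>"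
proof -
  have "real N * norm \<xi> \<le> real N * norm (\<xi> - \<eta>) + real N * norm \<eta>"
    using mult_left_mono[OF norm_triangle_sub[of \<xi> \<eta>], of "real N"] by (simp add: algebra_simps)
  moreover have "0 \<le> real N * norm (\<xi> - \<eta>)" "0 \<le> real N * norm \<eta>" by auto
  ultimately show ?thesis unfolding low_cut_def by linarith
qed

lemma low_cut_mono: "N \<le> N' \<Longrightarrow> low_cut N \<xi> \<le> low_cut N' \<xi>"
  unfolding low_cut_def by (intro min.mono mult_right_mono) auto

text \<open>Below frequency 1 the linear factor is at most a multiple of
  \<open>norm \<xi> powr s\<close> because \<open>s < 1\<close>; above it the weight is at least 1.
  Using \<open>Suc N\<close> keeps the constant at least 1 even for \<open>N = 0\<close>.\<close>

lemma low_cut_le_gev_weight: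
  assumes "a > 0" "0 \<le> s" "s < 1" "\<xi> \<noteq> 0"
  shows "(low_cut N \<xi>)\<^sup>2 \<le> (real (Suc N))\<^sup>2 * gev_weight a \<sigma> s \<xi>"
proof -
  let ?r = "norm \<xi>"
  have r: "?r > 0" using assms by simp
  have "(low_cut N \<xi>)\<^sup>2 \<le> (real (Suc N))\<^sup>2 * ?r powr (2 * s)"
  proof (cases "?r \<le> 1")
    case True
    have "(low_cut N \<xi>)\<^sup>2 \<le> (real (Suc N) * ?r)\<^sup>2"
      using r by (intro power_mono) (auto simp: low_cut_def algebra_simps min_le_iff_disj)
    also have "\<dots> = (real (Suc N))\<^sup>2 * ?r powr 2"
      using r by (simp add: power_mult_distrib powr_numeral)
    also have "\<dots> \<le> (real (Suc N))\<^sup>2 * ?r powr (2 * s)"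
      using r True assms by (intro mult_left_mono powr_mono') auto
    finally show ?thesis .
  next
    case False
    have "(low_cut N \<xi>)\<^sup>2 \<le> 1\<^sup>2 * 1"
      using low_cut_bounds[of N \<xi>] power_mono[of "low_cut N \<xi>" 1 2] by simp
    also have "\<dots> \<le> (real (Suc N))\<^sup>2 * ?r powr (2 * s)"
      using False assms by (intro mult_mono power_mono ge_one_powr_ge_zero) auto
    finally show ?thesis .
  qed
  also have "\<dots> \<le> (real (Suc N))\<^sup>2 * gev_weight a \<sigma> s \<xi>"
    unfolding gev_weight_def using assms by (intro mult_left_mono) (auto simp: mult_le_cancel_left1)
  finally show ?thesis .
qed

subsection \<open>Small solutions\<close>

locale small_qg_solution =
  fixes a \<sigma> s :: real and th0 :: "real^2 \<Rightarrow> complex" and th :: "real \<Rightarrow> real^2 \<Rightarrow> complex"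
  assumes a: "a > 0" and \<sigma>: "\<sigma> > 1" and s: "0 \<le> s" "s < 1"
    and th0_measurable [measurable]: "th0 \<in> borel_measurable borel"
    and sol: "in_sol_space a \<sigma> s th" and mild: "is_mild_sol th0 th"
    and small: "(\<integral>\<^sup>+\<xi>. ennreal (cmod (th0 \<xi>)) \<partial>lborel) \<le> 1"
begin

lemma th_measurable [measurable]: "t \<ge> 0 \<Longrightarrow> th t \<in> borel_measurable borel"
  using sol by (auto simp: in_sol_space_def in_Hdot_def)

text \<open>Only half of the dissipation enters the weight; the other half pays for the derivative
  in the nonlinearity. Truncation at \<open>R\<close> bounds the weight by
  \<open>exp R\<close>.\<close>

definition weighted_mod :: "real \<Rightarrow> real^2 \<Rightarrow> real \<Rightarrow> ennreal" where
  "weighted_mod R \<xi> t = ennreal (exp (min (t * norm \<xi> / 2) R) * cmod (th t \<xi>))"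

definition running_sup :: "real \<Rightarrow> real \<Rightarrow> real^2 \<Rightarrow> ennreal" where
  "running_sup R T \<xi> = rat_sup (weighted_mod R \<xi>) T"

text \<open>Up to the factor \<open>exp R\<close> this is a majorant of
  \<open>running_sup R T\<close> that does not depend on \<open>T\<close>, and the Chemin-Lerner
  norm controls it.\<close>

definition modulus_sup :: "real^2 \<Rightarrow> ennreal" where
  "modulus_sup \<xi> = (SUP q\<in>\<rat> \<inter> {0..}. ennreal (cmod (th q \<xi>)))"

lemma countable_nonneg_Rats: "countable (\<rat> \<inter> {0::real..})" "countable (\<rat> \<inter> {0::real..T})"
  using countable_rat by auto

lemma running_sup_measurable [measurable]: "running_sup R T \<in> borel_measurable borel"
proof -
  have "(\<lambda>\<xi>. SUP q\<in>\<rat> \<inter> {0..T}. weighted_mod R \<xi> q) \<in> borel_measurable borel"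
    unfolding weighted_mod_def by (intro borel_measurable_SUP countable_nonneg_Rats) auto
  then show ?thesis by (simp add: running_sup_def[abs_def] rat_sup_def)
qed

lemma modulus_sup_measurable [measurable]: "modulus_sup \<in> borel_measurable borel"
  unfolding modulus_sup_def[abs_def] by (intro borel_measurable_SUP countable_nonneg_Rats) auto

section \<open>Continuity in time through Duhamel's formula\<close>

definition duhamel :: "real^2 \<Rightarrow> real \<Rightarrow> complex" where
  "duhamel \<xi> t = complex_of_real (exp (- t * norm \<xi>)) * th0 \<xi>
     - (\<integral>z\<in>{0..t}. complex_of_real (exp (- (t - z) * norm \<xi>)) * div_nonlin th z \<xi> \<partial>lborel)"

text \<open>The mild formulation holds only up to a null set depending on the time.  At a good frequency
it holds at all rational times, and there the continuous function \<open>duhamel \<xi>\<close> replaces \<open>th\<close>.\<close>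
definition good :: "real^2 \<Rightarrow> bool" where
  "good \<xi> \<longleftrightarrow> (\<forall>q\<in>\<rat> \<inter> {0..}.
     set_integrable lborel {0..q} (\<lambda>z. complex_of_real (exp (- (q - z) * norm \<xi>)) * div_nonlin th z \<xi>)
     \<and> th q \<xi> = duhamel \<xi> q)"

lemma AE_duhamel: "t \<ge> 0 \<Longrightarrow> AE \<xi> in lborel. th t \<xi> = duhamel \<xi> t"
  using mild unfolding is_mild_sol_def duhamel_def by (fast elim: eventually_mono)

lemma AE_good: "AE \<xi> in lborel. good \<xi>"
  unfolding good_def
proof (subst AE_ball_countable[OF countable_nonneg_Rats(1)], intro ballI)
  fix q :: real assume "q \<in> \<rat> \<inter> {0..}"
  then show "AE \<xi> in lborel. set_integrable lborel {0..q}
      (\<lambda>z. complex_of_real (exp (- (q - z) * norm \<xi>)) * div_nonlin th z \<xi>) \<and> th q \<xi> = duhamel \<xi> q"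
    using mild unfolding is_mild_sol_def duhamel_def by (fastforce elim: eventually_mono)
qed

text \<open>Pulling \<open>exp (- t * norm \<xi>)\<close> out of the integral leaves an integrand
  independent of \<open>t\<close>, whose indefinite integral is continuous.\<close>

lemma continuous_on_duhamel:
  assumes "good \<xi>"
  shows "continuous_on {0..} (duhamel \<xi>)"
proof -
  let ?r = "norm \<xi>"
  let ?f = "\<lambda>z. complex_of_real (exp (z * ?r)) * div_nonlin th z \<xi>"
  have cont: "continuous_on {0..real n} (duhamel \<xi>)" for n
  proof -
    \<comment> \<open>A natural number is a rational time, so \<open>good \<xi>\<close> gives
      integrability up to \<open>real n\<close>.\<close>
    have "set_integrable lborel {0..real n} (\<lambda>z. complex_of_real (exp (- (real n - z) * ?r)) * div_nonlin th z \<xi>)"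
      using assms unfolding good_def by auto
    then have "set_integrable lborel {0..real n} (\<lambda>z. complex_of_real (exp (real n * ?r)) *
        (complex_of_real (exp (- (real n - z) * ?r)) * div_nonlin th z \<xi>))"
      by (rule set_integrable_mult_right)
    then have int: "set_integrable lborel {0..real n} ?f"
      unfolding of_real_exp_mult_exp by (simp add: algebra_simps)
    have "continuous_on {0..real n} (\<lambda>t. complex_of_real (exp (- t * ?r)) * (th0 \<xi> - integral {0..t} ?f))"
      using indefinite_integral_continuous_1[OF set_borel_integral_eq_integral(1)[OF int]]
      by (intro continuous_intros) auto
    moreover have "complex_of_real (exp (- t * ?r)) * (th0 \<xi> - integral {0..t} ?f) = duhamel \<xi> t"
      if "t \<in> {0..real n}" for t
    proof -
      have "set_integrable lborel {0..t} ?f"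
        by (rule set_integrable_subset[OF int]) (use that in auto)
      then have "integral {0..t} ?f = (\<integral>z\<in>{0..t}. ?f z \<partial>lborel)"
        by (simp add: set_borel_integral_eq_integral)
      then have "complex_of_real (exp (- t * ?r)) * integral {0..t} ?f
          = (\<integral>z\<in>{0..t}. complex_of_real (exp (- t * ?r)) * ?f z \<partial>lborel)"
        by simp
      also have "\<dots> = (\<integral>z\<in>{0..t}. complex_of_real (exp (- (t - z) * ?r)) * div_nonlin th z \<xi> \<partial>lborel)"
        unfolding of_real_exp_mult_exp by (simp add: algebra_simps)
      finally show ?thesis by (simp add: duhamel_def right_diff_distrib)
    qed
    ultimately show ?thesis by (rule continuous_on_eq)
  qed
  show ?thesis
    unfolding continuous_on_eq_continuous_within
  proof
    fix t :: real assume t: "t \<in> {0..}"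
    obtain n where n: "t < real n" using reals_Archimedean2 by blast
    have "at t within {0..} = at t within {0..real n}"
      by (rule at_within_nhd[of t "{..<real n}"]) (use n in auto)
    moreover have "continuous (at t within {0..real n}) (duhamel \<xi>)"
      using cont[of n] t n by (auto simp: continuous_on_eq_continuous_within)
    ultimately show "continuous (at t within {0..}) (duhamel \<xi>)" by (simp add: continuous_within)
  qed
qed

definition duhamel_mod :: "real \<Rightarrow> real^2 \<Rightarrow> real \<Rightarrow> ennreal" where
  "duhamel_mod R \<xi> t = ennreal (exp (min (t * norm \<xi> / 2) R) * cmod (duhamel \<xi> t))"

lemma running_sup_eq: "good \<xi> \<Longrightarrow> running_sup R T \<xi> = rat_sup (duhamel_mod R \<xi>) T"
  unfolding running_sup_def rat_sup_def by (intro SUP_cong refl) (auto simp: good_def weighted_mod_def duhamel_mod_def)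

lemma continuous_on_duhamel_mod: "good \<xi> \<Longrightarrow> continuous_on {0..} (duhamel_mod R \<xi>)"
  unfolding duhamel_mod_def by (intro continuous_on_ennreal continuous_intros continuous_on_duhamel) simp_all

text \<open>At an arbitrary, possibly irrational \<open>t\<close>, the mild formula identifies
  \<open>th t\<close> with its continuous version outside a null set depending on \<open>t\<close>;
  continuity then compares it with rational times.\<close>

lemma AE_weighted_mod_le_running_sup:
  assumes "0 \<le> t" "t \<le> T"
  shows "AE \<xi> in lborel. weighted_mod R \<xi> t \<le> running_sup R T \<xi>"
  using AE_good AE_duhamel[OF assms(1)]
proof eventually_elim
  case (elim \<xi>)
  have "duhamel_mod R \<xi> t \<le> rat_sup (duhamel_mod R \<xi>) T"
    by (rule le_rat_sup[OF continuous_on_duhamel_mod[OF elim(1)] assms])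
  then show ?case using elim by (simp add: running_sup_eq weighted_mod_def duhamel_mod_def)
qed

lemma running_sup_mono: "T \<le> T' \<Longrightarrow> R \<le> R' \<Longrightarrow> running_sup R T \<xi> \<le> running_sup R' T' \<xi>"
  unfolding running_sup_def rat_sup_def
  by (intro SUP_mono) (force simp: weighted_mod_def intro!: ennreal_leI mult_right_mono)

lemma running_sup_le_modulus_sup: "running_sup R T \<xi> \<le> ennreal (exp R) * modulus_sup \<xi>"
  unfolding running_sup_def rat_sup_def
proof (rule SUP_least)
  fix q assume q: "q \<in> \<rat> \<inter> {0..T}"
  have "weighted_mod R \<xi> q \<le> ennreal (exp R * cmod (th q \<xi>))"
    unfolding weighted_mod_def by (intro ennreal_leI mult_right_mono) auto
  also have "\<dots> = ennreal (exp R) * ennreal (cmod (th q \<xi>))" by (simp add: ennreal_mult)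
  also have "\<dots> \<le> ennreal (exp R) * modulus_sup \<xi>"
    unfolding modulus_sup_def using q by (intro mult_left_mono SUP_upper) auto
  finally show "weighted_mod R \<xi> q \<le> ennreal (exp R) * modulus_sup \<xi>" .
qed

text \<open>The Chemin-Lerner norm has its supremum inside the frequency integral, so it dominates
  the supremum over rational times pointwise.\<close>

lemma nn_integral_gev_modulus_sup_finite:
  "(\<integral>\<^sup>+\<xi>. ennreal (gev_weight a \<sigma> s \<xi>) * (modulus_sup \<xi>)\<^sup>2 \<partial>lborel) < \<infinity>"
proof -
  have "(\<integral>\<^sup>+\<xi>. ennreal (gev_weight a \<sigma> s \<xi>) * (modulus_sup \<xi>)\<^sup>2 \<partial>lborel) \<le> CL_sq a \<sigma> s th"
    unfolding CL_sq_def
  proof (intro nn_integral_mono mult_left_mono)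
    fix \<xi>
    have "(modulus_sup \<xi>)\<^sup>2 \<le> (SUP q\<in>\<rat> \<inter> {0..}. (ennreal (cmod (th q \<xi>)))\<^sup>2)"
      unfolding modulus_sup_def by (rule SUP_power2_le_ennreal)
    also have "\<dots> \<le> (SUP t\<in>{0..}. ennreal ((cmod (th t \<xi>))\<^sup>2))"
      by (intro SUP_subset_mono) (auto simp: ennreal_power)
    finally show "(modulus_sup \<xi>)\<^sup>2 \<le> (SUP t\<in>{0..}. ennreal ((cmod (th t \<xi>))\<^sup>2))" .
  qed simp
  then show ?thesis using sol by (auto simp: in_sol_space_def)
qed

lemma gev_recip_finite: "gev_recip a \<sigma> s < \<infinity>"
  unfolding gev_recip_def
  by (rule nn_integral_powr_exp_plane_finite) (use a \<sigma> s in auto)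

lemma nn_integral_modulus_sup_finite: "(\<integral>\<^sup>+\<xi>. modulus_sup \<xi> \<partial>lborel) < \<infinity>"
proof -
  have "(\<integral>\<^sup>+\<xi>. modulus_sup \<xi> \<partial>lborel)\<^sup>2 < \<infinity>"
    by (rule le_less_trans[OF power2_nn_integral_le_gev[of _ a \<sigma> s]])
      (use nn_integral_gev_modulus_sup_finite gev_recip_finite in \<open>auto simp: ennreal_mult_less_top\<close>)
  then show ?thesis by (simp add: power_less_top_ennreal)
qed


section \<open>The pointwise quadratic inequality\<close>

text \<open>Subadditivity of the truncated exponent splits the weight over
  \<open>\<xi> - \<eta>\<close> and \<open>\<eta>\<close>, and the kernel costs one factor
  \<open>norm \<xi>\<close>.\<close>

lemma cut_exp_mult_div_nonlin_le:
  assumes z: "0 \<le> z" "z \<le> T" and R: "R \<ge> 0"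
  shows "ennreal (exp (min (z * norm \<xi> / 2) R)) * ennreal (cmod (div_nonlin th z \<xi>))
    \<le> ennreal (norm \<xi> / (4 * pi\<^sup>2)) * nconv (running_sup R T) (running_sup R T) \<xi>"
proof -
  let ?E = "\<lambda>\<xi>::real^2. exp (min (z * norm \<xi> / 2) R)"
  have sub: "?E \<xi> \<le> ?E (\<xi> - \<eta>) * ?E \<eta>" for \<eta>
  proof -
    have "z * norm \<xi> \<le> z * norm (\<xi> - \<eta>) + z * norm \<eta>"
      using mult_left_mono[OF norm_triangle_sub[of \<xi> \<eta>], of z] z by (simp add: algebra_simps)
    moreover have "0 \<le> z * norm (\<xi> - \<eta>)" "0 \<le> z * norm \<eta>" using z by auto
    ultimately have "min (z * norm \<xi> / 2) R \<le> min (z * norm (\<xi> - \<eta>) / 2) R + min (z * norm \<eta> / 2) R"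
      using R by (auto simp: min_def)
    then show ?thesis by (simp flip: exp_add)
  qed
  \<comment> \<open>The almost-everywhere bound is used at \<open>\<eta>\<close> and, by reflection
    invariance of Lebesgue measure, at \<open>\<xi> - \<eta>\<close>.\<close>
  have AE: "AE \<eta> in lborel. ennreal (?E \<xi> * cmod (qg_integrand th z \<xi> \<eta>))
      \<le> ennreal (norm \<xi>) * (running_sup R T (\<xi> - \<eta>) * running_sup R T \<eta>)"
    using AE_weighted_mod_le_running_sup[OF z, of R] AE_lborel_reflect[OF AE_weighted_mod_le_running_sup[OF z, of R], of \<xi>]
  proof eventually_elim
    case (elim \<eta>)
    have "?E \<xi> * cmod (qg_integrand th z \<xi> \<eta>)
      = ?E \<xi> * (\<bar>qg_kernel \<xi> \<eta>\<bar> * (cmod (th z (\<xi> - \<eta>)) * cmod (th z \<eta>)))"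
      by (simp add: qg_integrand_def norm_mult)
    also have "\<dots> \<le> (?E (\<xi> - \<eta>) * ?E \<eta>) * (norm \<xi> * (cmod (th z (\<xi> - \<eta>)) * cmod (th z \<eta>)))"
      by (intro mult_mono sub mult_right_mono qg_kernel_le) auto
    also have "\<dots> = norm \<xi> * ((?E (\<xi> - \<eta>) * cmod (th z (\<xi> - \<eta>))) * (?E \<eta> * cmod (th z \<eta>)))"
      by simp
    finally have "ennreal (?E \<xi> * cmod (qg_integrand th z \<xi> \<eta>))
        \<le> ennreal (norm \<xi> * ((?E (\<xi> - \<eta>) * cmod (th z (\<xi> - \<eta>))) * (?E \<eta> * cmod (th z \<eta>))))"
      by (rule ennreal_leI)
    also have "\<dots> = ennreal (norm \<xi>) * (weighted_mod R (\<xi> - \<eta>) z * weighted_mod R \<eta> z)"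
      by (simp add: weighted_mod_def ennreal_mult)
    also have "\<dots> \<le> ennreal (norm \<xi>) * (running_sup R T (\<xi> - \<eta>) * running_sup R T \<eta>)"
      using elim by (intro mult_mono) auto
    finally show ?case .
  qed
  have "ennreal (?E \<xi>) * ennreal (cmod (div_nonlin th z \<xi>))
    = ennreal (1 / (4 * pi\<^sup>2)) * ennreal (cmod (\<integral>\<eta>. complex_of_real (?E \<xi>) * qg_integrand th z \<xi> \<eta> \<partial>lborel))"
    by (simp add: div_nonlin_def norm_mult norm_divide norm_power flip: ennreal_mult)
  also have "\<dots> \<le> ennreal (1 / (4 * pi\<^sup>2)) *
      (\<integral>\<^sup>+\<eta>. ennreal (cmod (complex_of_real (?E \<xi>) * qg_integrand th z \<xi> \<eta>)) \<partial>lborel)"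
    by (intro mult_left_mono norm_integral_le_nn_integral) auto
  also have "\<dots> \<le> ennreal (1 / (4 * pi\<^sup>2)) *
      (\<integral>\<^sup>+\<eta>. ennreal (norm \<xi>) * (running_sup R T (\<xi> - \<eta>) * running_sup R T \<eta>) \<partial>lborel)"
    using AE by (intro mult_left_mono nn_integral_mono_AE) (auto simp: norm_mult)
  also have "\<dots> = ennreal (norm \<xi> / (4 * pi\<^sup>2)) * nconv (running_sup R T) (running_sup R T) \<xi>"
  proof -
    have "ennreal (norm \<xi> / (4 * pi\<^sup>2)) = ennreal (1 / (4 * pi\<^sup>2)) * ennreal (norm \<xi>)"
      by (simp flip: ennreal_mult)
    then show ?thesis by (subst nn_integral_cmult) (simp_all add: nconv_def mult.assoc)
  qed
  finally show ?thesis .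
qed

text \<open>The weight at time \<open>t\<close> is at most the weight at \<open>z\<close> times
  \<open>exp ((t - z) * norm \<xi> / 2)\<close>. Half of the semigroup absorbs this factor, and the
  time integral of the other half absorbs \<open>norm \<xi>\<close>.\<close>

lemma weighted_mod_le_data_add_nconv:
  assumes t: "0 \<le> t" "t \<le> T" and R: "R \<ge> 0" and eq: "th t \<xi> = duhamel \<xi> t"
  shows "weighted_mod R \<xi> t \<le> ennreal (cmod (th0 \<xi>)) + ennreal (1 / (2 * pi\<^sup>2)) * nconv (running_sup R T) (running_sup R T) \<xi>"
proof -
  let ?r = "norm \<xi>"
  let ?E = "\<lambda>t. exp (min (t * ?r / 2) R)"
  let ?Q = "nconv (running_sup R T) (running_sup R T) \<xi>"
  let ?N = "\<lambda>z. complex_of_real (exp (- (t - z) * ?r)) * div_nonlin th z \<xi>"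
  define I where "I = (\<integral>z\<in>{0..t}. ?N z \<partial>lborel)"
  have "cmod (th t \<xi>) \<le> exp (- t * ?r) * cmod (th0 \<xi>) + cmod I"
    unfolding eq duhamel_def I_def[symmetric]
    by (rule order_trans[OF norm_triangle_ineq4]) (simp add: norm_mult)
  then have "?E t * cmod (th t \<xi>) \<le> ?E t * (exp (- t * ?r) * cmod (th0 \<xi>) + cmod I)"
    by (rule mult_left_mono) simp
  also have "\<dots> = (?E t * exp (- t * ?r)) * cmod (th0 \<xi>) + ?E t * cmod I"
    by (simp add: algebra_simps)
  \<comment> \<open>The truncated exponent is at most \<open>t * ?r / 2\<close>.\<close>
  also have "?E t * exp (- t * ?r) \<le> 1"
  proof -
    have "0 \<le> t * ?r" using t by simp
    then show ?thesis by (simp flip: exp_add)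
  qed
  finally have "?E t * cmod (th t \<xi>) \<le> cmod (th0 \<xi>) + ?E t * cmod I"
    by (simp add: mult_left_le_one_le mult_right_mono)
  then have "weighted_mod R \<xi> t \<le> ennreal (cmod (th0 \<xi>)) + ennreal (?E t) * ennreal (cmod I)"
    unfolding weighted_mod_def by (metis ennreal_leI ennreal_plus ennreal_mult norm_ge_zero exp_ge_zero mult_nonneg_nonneg)
  moreover have "ennreal (?E t) * ennreal (cmod I) \<le> ennreal (1 / (2 * pi\<^sup>2)) * ?Q"
  proof -
    have "ennreal (?E t) * ennreal (cmod I)
        = ennreal (cmod (\<integral>z. complex_of_real (?E t) * (indicator {0..t} z *\<^sub>R ?N z) \<partial>lborel))"
      unfolding I_def set_lebesgue_integral_def by (simp only: integral_mult_right_zero) (simp add: norm_mult ennreal_mult)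
    also have "\<dots> \<le> (\<integral>\<^sup>+z. ennreal (cmod (complex_of_real (?E t) * (indicator {0..t} z *\<^sub>R ?N z))) \<partial>lborel)"
      by (rule norm_integral_le_nn_integral)
    also have "\<dots> = (\<integral>\<^sup>+z. ennreal (?E t) * ennreal (cmod (indicator {0..t} z *\<^sub>R ?N z)) \<partial>lborel)"
      by (intro nn_integral_cong) (simp add: norm_mult flip: ennreal_mult)
    also have "\<dots> \<le> (\<integral>\<^sup>+z. (ennreal (?r * exp (- (t - z) * ?r / 2)) * indicator {0..t} z)
        * (ennreal (1 / (4 * pi\<^sup>2)) * ?Q) \<partial>lborel)"
    proof (rule nn_integral_mono)
      fix z :: real
      show "ennreal (?E t) * ennreal (cmod (indicator {0..t} z *\<^sub>R ?N z))
        \<le> (ennreal (?r * exp (- (t - z) * ?r / 2)) * indicator {0..t} z) * (ennreal (1 / (4 * pi\<^sup>2)) * ?Q)"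
      proof (cases "z \<in> {0..t}")
        case True
        \<comment> \<open>Moving from time \<open>z\<close> to time \<open>t\<close> raises the
          truncated exponent by at most \<open>(t - z) * ?r / 2\<close>.\<close>
        have "?E t \<le> ?E z * exp ((t - z) * ?r / 2)"
        proof -
          define d where "d = (t - z) * ?r / 2"
          have "0 \<le> d" using True by (simp add: d_def)
          moreover have "t * ?r / 2 = z * ?r / 2 + d" by (simp add: d_def algebra_simps add_divide_distrib diff_divide_distrib)
          ultimately have "min (t * ?r / 2) R \<le> min (z * ?r / 2) R + (t - z) * ?r / 2"
            unfolding d_def[symmetric] by (auto simp: min_def)
          then show ?thesis by (simp flip: exp_add)
        qed
        then have "?E t * cmod (?N z) \<le> (?E z * exp ((t - z) * ?r / 2)) * (exp (- (t - z) * ?r) * cmod (div_nonlin th z \<xi>))"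
          by (simp add: norm_mult mult_right_mono)
        also have "\<dots> = (exp ((t - z) * ?r / 2) * exp (- (t - z) * ?r)) * (?E z * cmod (div_nonlin th z \<xi>))"
          by simp
        also have "exp ((t - z) * ?r / 2) * exp (- (t - z) * ?r) = exp (- (t - z) * ?r / 2)"
          unfolding exp_add[symmetric] mult_minus_left by (rule arg_cong[where f = exp]) linarith
        finally have "ennreal (?E t * cmod (?N z)) \<le> ennreal (exp (- (t - z) * ?r / 2) * (?E z * cmod (div_nonlin th z \<xi>)))"
          by (rule ennreal_leI)
        also have "\<dots> = ennreal (exp (- (t - z) * ?r / 2)) * (ennreal (?E z) * ennreal (cmod (div_nonlin th z \<xi>)))"
          by (simp add: ennreal_mult)
        also have "\<dots> \<le> ennreal (exp (- (t - z) * ?r / 2)) * (ennreal (?r / (4 * pi\<^sup>2)) * ?Q)"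
          using True t R by (intro mult_left_mono cut_exp_mult_div_nonlin_le) auto
        also have "ennreal (?r / (4 * pi\<^sup>2)) = ennreal ?r * ennreal (1 / (4 * pi\<^sup>2))"
          by (simp flip: ennreal_mult')
        also have "ennreal (exp (- (t - z) * ?r / 2)) * (ennreal ?r * ennreal (1 / (4 * pi\<^sup>2)) * ?Q)
            = ennreal (?r * exp (- (t - z) * ?r / 2)) * (ennreal (1 / (4 * pi\<^sup>2)) * ?Q)"
          by (simp add: ennreal_mult mult_ac)
        finally show ?thesis using True by (simp add: ennreal_mult)
      qed simp
    qed
    also have "\<dots> = (\<integral>\<^sup>+z. ennreal (?r * exp (- (t - z) * ?r / 2)) * indicator {0..t} z \<partial>lborel)
        * (ennreal (1 / (4 * pi\<^sup>2)) * ?Q)"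
      by (rule nn_integral_multc) measurable
    \<comment> \<open>The time integral contributes the factor 2 that turns
      \<open>1 / (4 * pi\<^sup>2)\<close> into \<open>1 / (2 * pi\<^sup>2)\<close>.\<close>
    also have "\<dots> \<le> 2 * (ennreal (1 / (4 * pi\<^sup>2)) * ?Q)"
      using nn_integral_exp_Icc_le[of ?r t] t by (intro mult_right_mono) auto
    also have "\<dots> = ennreal (1 / (2 * pi\<^sup>2)) * ?Q"
      by (simp add: mult.assoc[symmetric] flip: ennreal_numeral ennreal_mult)
    finally show ?thesis .
  qed
  ultimately show ?thesis by (auto intro: order_trans add_left_mono)
qed

lemma AE_running_sup_le:
  assumes R: "R \<ge> 0"
  shows "AE \<xi> in lborel. running_sup R T \<xi> \<le> ennreal (cmod (th0 \<xi>)) + ennreal (1 / (2 * pi\<^sup>2)) * nconv (running_sup R T) (running_sup R T) \<xi>"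
  using AE_good
proof eventually_elim
  case (elim \<xi>)
  then show ?case
    unfolding running_sup_def[of R T \<xi>] rat_sup_def
    by (intro SUP_least weighted_mod_le_data_add_nconv R) (auto simp: good_def)
qed

section \<open>Uniform L^1 bound by a continuity argument\<close>

text \<open>Dominated convergence: at good frequencies the running supremum is continuous in
  \<open>T\<close>, and \<open>exp R\<close> times \<open>modulus_sup\<close> is an integrable
  majorant.\<close>

lemma continuous_on_nn_integral_running_sup:
  "continuous_on {0..} (\<lambda>T. \<integral>\<^sup>+\<xi>. running_sup R T \<xi> \<partial>lborel)"
  unfolding continuous_on_sequentially o_def
proof (intro allI impI ballI, elim conjE)
  fix X :: "nat \<Rightarrow> real" and T assume T: "T \<in> {0..}" "\<forall>n. X n \<in> {0..}" "X \<longlonglongrightarrow> T"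
  show "(\<lambda>n. \<integral>\<^sup>+\<xi>. running_sup R (X n) \<xi> \<partial>lborel) \<longlonglongrightarrow> (\<integral>\<^sup>+\<xi>. running_sup R T \<xi> \<partial>lborel)"
  proof (rule nn_integral_dominated_convergence[where w = "\<lambda>\<xi>. ennreal (exp R) * modulus_sup \<xi>"])
    show "(\<integral>\<^sup>+\<xi>. ennreal (exp R) * modulus_sup \<xi> \<partial>lborel) < \<infinity>"
      using nn_integral_modulus_sup_finite by (simp add: nn_integral_cmult ennreal_mult_less_top)
    show "AE \<xi> in lborel. (\<lambda>n. running_sup R (X n) \<xi>) \<longlonglongrightarrow> running_sup R T \<xi>"
      using AE_good
    proof eventually_elim
      case (elim \<xi>)
      show ?case
        unfolding running_sup_eq[OF elim]
        using continuous_on_rat_sup[OF continuous_on_duhamel_mod[OF elim, of R]] T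
        unfolding continuous_on_sequentially o_def by blast
    qed
  qed (auto intro: running_sup_le_modulus_sup)
qed

text \<open>As a function of \<open>T\<close> the integral is continuous, starts at most at 1 and
  never equals 2, so the intermediate value theorem keeps it below 2. The bound is uniform in
  \<open>R\<close> and \<open>T\<close>.\<close>

lemma nn_integral_running_sup_le:
  assumes R: "R \<ge> 0" and T: "T \<ge> 0"
  shows "(\<integral>\<^sup>+\<xi>. running_sup R T \<xi> \<partial>lborel) \<le> 2"
proof (rule ccontr)
  let ?g = "\<lambda>T. \<integral>\<^sup>+\<xi>. running_sup R T \<xi> \<partial>lborel"
  assume "\<not> ?g T \<le> 2"
  then have "2 \<le> ?g T" by simp
  moreover have "?g 0 \<le> 2"
  proof -
    have "?g 0 = (\<integral>\<^sup>+\<xi>. ennreal (cmod (th0 \<xi>)) \<partial>lborel)"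
    proof (rule nn_integral_cong_AE, use AE_duhamel[of 0, simplified] in eventually_elim)
      case (elim \<xi>)
      \<comment> \<open>At horizon 0 only time 0 remains; there the weight is 1 because
        \<open>R \<ge> 0\<close>, and Duhamel's integral runs over a null set.\<close>
      have "\<rat> \<inter> {0..0::real} = {0}" by auto
      moreover have "th 0 \<xi> = th0 \<xi>"
      proof -
        have "(\<integral>z\<in>{0..0}. complex_of_real (exp (- (0 - z) * norm \<xi>)) * div_nonlin th z \<xi> \<partial>lborel) = 0"
          unfolding set_lebesgue_integral_def
          by (rule integral_eq_zero_AE, rule eventually_mono[OF AE_lborel_singleton[of 0]]) auto
        then show ?thesis using elim by (simp only: duhamel_def) simp
      qed
      ultimately show ?case
        using R by (simp add: running_sup_def rat_sup_def weighted_mod_def)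
    qed
    also have "\<dots> \<le> 1" by (rule small)
    also have "\<dots> \<le> 2" by simp
    finally show ?thesis .
  qed
  \<comment> \<open>The value 2 is excluded because \<open>2 > 1 + 2\<^sup>2 / (2 pi\<^sup>2)\<close>.\<close>
  ultimately obtain x where x: "0 \<le> x" "?g x = 2"
    using IVT'[of ?g 0 2 T] T continuous_on_subset[OF continuous_on_nn_integral_running_sup, of "{0..T}" R] by auto
  have "?g x \<le> (\<integral>\<^sup>+\<xi>. ennreal (cmod (th0 \<xi>)) + ennreal (1 / (2 * pi\<^sup>2)) * nconv (running_sup R x) (running_sup R x) \<xi> \<partial>lborel)"
    by (intro nn_integral_mono_AE AE_running_sup_le R)
  also have "\<dots> = (\<integral>\<^sup>+\<xi>. ennreal (cmod (th0 \<xi>)) \<partial>lborel) + ennreal (1 / (2 * pi\<^sup>2)) * (?g x * ?g x)"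
    by (simp add: nn_integral_add nn_integral_cmult nn_integral_nconv)
  also have "\<dots> \<le> 1 + ennreal (1 / (2 * pi\<^sup>2)) * 4"
    using x small by (intro add_mono mult_left_mono) auto
  also have "\<dots> = ennreal (1 + 1 / (2 * pi\<^sup>2) * 4)"
    by (simp flip: ennreal_1 ennreal_numeral ennreal_mult ennreal_plus)
  also have "\<dots> < ennreal 2"
  proof (rule ennreal_lessI)
    have "pi * pi > 2 * 2" using pi_gt3 by (intro mult_strict_mono) auto
    then show "1 + 1 / (2 * pi\<^sup>2) * 4 < 2" by (simp add: power2_eq_square field_simps)
  qed simp
  finally show False using x by simp
qed

section \<open>L^2 bound uniform in the truncations\<close>

text \<open>Truncation level, time horizon and cutoff share the index \<open>N\<close>, so the
  family increases in \<open>N\<close> and one monotone limit removes all three.\<close>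

definition cut_sup :: "nat \<Rightarrow> real^2 \<Rightarrow> ennreal" where
  "cut_sup N \<xi> = ennreal (low_cut N \<xi>) * running_sup (real N) (real N) \<xi>"

lemma cut_sup_measurable [measurable]: "cut_sup N \<in> borel_measurable borel"
  unfolding cut_sup_def[abs_def] by measurable

text \<open>The Gevrey weight dominates the cutoff, and \<open>exp (real N)\<close> the truncated
  exponential. The resulting bound depends on \<open>N\<close>; its purpose is to permit absorption
  in the uniform estimate.\<close>

lemma nn_integral_cut_sup_finite: "(\<integral>\<^sup>+\<xi>. (cut_sup N \<xi>)\<^sup>2 \<partial>lborel) < \<infinity>"
proof -
  have "(\<integral>\<^sup>+\<xi>. (cut_sup N \<xi>)\<^sup>2 \<partial>lborel)
    \<le> (\<integral>\<^sup>+\<xi>. ennreal ((real (Suc N))\<^sup>2 * (exp (real N))\<^sup>2) * (ennreal (gev_weight a \<sigma> s \<xi>) * (modulus_sup \<xi>)\<^sup>2) \<partial>lborel)"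
  proof (rule nn_integral_mono_AE, use AE_lborel_nonzero in eventually_elim)
    case (elim \<xi>)
    have "(cut_sup N \<xi>)\<^sup>2 \<le> (ennreal (low_cut N \<xi>) * (ennreal (exp (real N)) * modulus_sup \<xi>))\<^sup>2"
      unfolding cut_sup_def by (intro power_mono mult_left_mono running_sup_le_modulus_sup) auto
    also have "\<dots> = ennreal ((low_cut N \<xi>)\<^sup>2) * (ennreal ((exp (real N))\<^sup>2) * (modulus_sup \<xi>)\<^sup>2)"
      by (simp add: power_mult_distrib ennreal_power low_cut_bounds)
    also have "\<dots> \<le> ennreal ((real (Suc N))\<^sup>2 * gev_weight a \<sigma> s \<xi>) * (ennreal ((exp (real N))\<^sup>2) * (modulus_sup \<xi>)\<^sup>2)"
      by (intro mult_right_mono ennreal_leI low_cut_le_gev_weight a s elim) auto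
    also have "\<dots> = ennreal ((real (Suc N))\<^sup>2 * (exp (real N))\<^sup>2) * (ennreal (gev_weight a \<sigma> s \<xi>) * (modulus_sup \<xi>)\<^sup>2)"
      by (simp add: ennreal_mult gev_weight_def mult_ac)
    finally show ?case .
  qed
  also have "\<dots> < \<infinity>"
    using nn_integral_gev_modulus_sup_finite by (simp add: nn_integral_cmult ennreal_mult_less_top)
  finally show ?thesis .
qed

text \<open>Multiplying the quadratic inequality by the subadditive cutoff places the cutoff on one
  factor or the other. The two convolutions agree by symmetry, which doubles the constant.\<close>

lemma AE_cut_sup_le:
  "AE \<xi> in lborel. cut_sup N \<xi> \<le> ennreal (cmod (th0 \<xi>)) + ennreal (1 / pi\<^sup>2) * nconv (running_sup N N) (cut_sup N) \<xi>"
  using AE_running_sup_le[of "real N" "real N", simplified]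
proof eventually_elim
  case (elim \<xi>)
  let ?G = "running_sup (real N) (real N)"
  let ?w = "low_cut N"
  have "ennreal (?w \<xi>) * nconv ?G ?G \<xi>
      \<le> (\<integral>\<^sup>+\<eta>. cut_sup N (\<xi> - \<eta>) * ?G \<eta> + ?G (\<xi> - \<eta>) * cut_sup N \<eta> \<partial>lborel)"
    unfolding nconv_def
  proof (subst nn_integral_cmult[symmetric], measurable, rule nn_integral_mono)
    fix \<eta>
    have "ennreal (?w \<xi>) * (?G (\<xi> - \<eta>) * ?G \<eta>)
        \<le> (ennreal (?w (\<xi> - \<eta>)) + ennreal (?w \<eta>)) * (?G (\<xi> - \<eta>) * ?G \<eta>)"
      by (intro mult_right_mono) (auto simp: low_cut_bounds low_cut_subadditive ennreal_leI simp flip: ennreal_plus)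
    then show "ennreal (?w \<xi>) * (?G (\<xi> - \<eta>) * ?G \<eta>) \<le> cut_sup N (\<xi> - \<eta>) * ?G \<eta> + ?G (\<xi> - \<eta>) * cut_sup N \<eta>"
      by (simp add: cut_sup_def distrib_right distrib_left mult_ac)
  qed
  also have "\<dots> = nconv (cut_sup N) ?G \<xi> + nconv ?G (cut_sup N) \<xi>"
    unfolding nconv_def by (rule nn_integral_add) measurable
  also have "\<dots> = 2 * nconv ?G (cut_sup N) \<xi>"
    using nconv_commute[of "cut_sup N" ?G \<xi>] by (simp add: mult_2)
  finally have conv: "ennreal (?w \<xi>) * nconv ?G ?G \<xi> \<le> 2 * nconv ?G (cut_sup N) \<xi>" .
  have "cut_sup N \<xi> \<le> ennreal (?w \<xi>) * (ennreal (cmod (th0 \<xi>)) + ennreal (1 / (2 * pi\<^sup>2)) * nconv ?G ?G \<xi>)"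
    unfolding cut_sup_def using elim by (intro mult_left_mono) auto
  also have "\<dots> = ennreal (?w \<xi>) * ennreal (cmod (th0 \<xi>))
      + ennreal (1 / (2 * pi\<^sup>2)) * (ennreal (?w \<xi>) * nconv ?G ?G \<xi>)"
    by (simp add: distrib_left mult_ac)
  also have "\<dots> \<le> 1 * ennreal (cmod (th0 \<xi>)) + ennreal (1 / (2 * pi\<^sup>2)) * (2 * nconv ?G (cut_sup N) \<xi>)"
    using low_cut_bounds[of N \<xi>] by (intro add_mono mult_mono conv) auto
  also have "ennreal (1 / (2 * pi\<^sup>2)) * (2 * nconv ?G (cut_sup N) \<xi>) = ennreal (1 / pi\<^sup>2) * nconv ?G (cut_sup N) \<xi>"
    by (simp add: mult.assoc[symmetric] flip: ennreal_numeral ennreal_mult)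
  finally show ?case by simp
qed

text \<open>Young's inequality takes \<open>running_sup\<close> in L^1, with norm at most 2, and
  \<open>cut_sup\<close> in L^2. The convolution term then has constant \<open>8 / pi ^ 4\<close>,
  at most 1/2, and is absorbed.\<close>

lemma nn_integral_cut_sup_le: "(\<integral>\<^sup>+\<xi>. (cut_sup N \<xi>)\<^sup>2 \<partial>lborel) \<le> 4 * L2_sq th0"
proof -
  let ?G = "running_sup (real N) (real N)"
  let ?J = "\<integral>\<^sup>+\<xi>. (cut_sup N \<xi>)\<^sup>2 \<partial>lborel"
  have "?J \<le> (\<integral>\<^sup>+\<xi>. 2 * ennreal ((cmod (th0 \<xi>))\<^sup>2) + ennreal (2 / pi ^ 4) * (nconv ?G (cut_sup N) \<xi>)\<^sup>2 \<partial>lborel)"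
  proof (rule nn_integral_mono_AE, use AE_cut_sup_le[of N] in eventually_elim)
    case (elim \<xi>)
    have "(cut_sup N \<xi>)\<^sup>2 \<le> (ennreal (cmod (th0 \<xi>)) + ennreal (1 / pi\<^sup>2) * nconv ?G (cut_sup N) \<xi>)\<^sup>2"
      by (rule power_mono[OF elim]) simp
    also have "\<dots> \<le> 2 * (ennreal (cmod (th0 \<xi>)))\<^sup>2 + 2 * (ennreal (1 / pi\<^sup>2) * nconv ?G (cut_sup N) \<xi>)\<^sup>2"
      by (rule power2_add_le_ennreal)
    also have "2 * (ennreal (1 / pi\<^sup>2) * nconv ?G (cut_sup N) \<xi>)\<^sup>2 = ennreal (2 / pi ^ 4) * (nconv ?G (cut_sup N) \<xi>)\<^sup>2"
      by (simp add: power_mult_distrib ennreal_power power_divide mult.assoc[symmetric]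
          flip: ennreal_numeral ennreal_mult)
    finally show ?case by (simp add: ennreal_power)
  qed
  also have "\<dots> = 2 * L2_sq th0 + ennreal (2 / pi ^ 4) * (\<integral>\<^sup>+\<xi>. (nconv ?G (cut_sup N) \<xi>)\<^sup>2 \<partial>lborel)"
    by (simp add: nn_integral_add nn_integral_cmult L2_sq_def)
  also have "\<dots> \<le> 2 * L2_sq th0 + ennreal (2 / pi ^ 4) * (2\<^sup>2 * ?J)"
    by (intro add_left_mono mult_left_mono order_trans[OF nn_integral_power2_nconv_le] mult_right_mono
        power_mono nn_integral_running_sup_le) auto
  also have "ennreal (2 / pi ^ 4) * (2\<^sup>2 * ?J) = ennreal (8 / pi ^ 4) * ?J"
  proof -
    have "(2::ennreal)\<^sup>2 = ennreal 4" by simp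
    then have "ennreal (2 / pi ^ 4) * 2\<^sup>2 = ennreal (2 / pi ^ 4 * 4)"
      by (simp only:) (subst ennreal_mult, simp_all)
    then show ?thesis by (simp only: mult.assoc[symmetric]) simp
  qed
  also have "\<dots> \<le> ennreal (1 / 2) * ?J"
  proof (intro mult_right_mono ennreal_leI)
    have "2 ^ 4 \<le> pi ^ 4" using pi_gt3 by (intro power_mono) auto
    then show "8 / pi ^ 4 \<le> 1 / 2" by (simp add: field_simps)
  qed simp
  finally have "?J \<le> 2 * L2_sq th0 + ennreal (1 / 2) * ?J" by (simp add: add_left_mono)
  from ennreal_le_double_of_le_add_half[OF this nn_integral_cut_sup_finite]
  show ?thesis by (simp add: mult.assoc[symmetric])
qed

section \<open>Removal of the truncations\<close>

definition envelope :: "real^2 \<Rightarrow> ennreal" where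
  "envelope \<xi> = (SUP N. cut_sup N \<xi>)"

lemma envelope_measurable [measurable]: "envelope \<in> borel_measurable borel"
  unfolding envelope_def[abs_def] by measurable

lemma nn_integral_envelope_le: "(\<integral>\<^sup>+\<xi>. (envelope \<xi>)\<^sup>2 \<partial>lborel) \<le> 4 * L2_sq th0"
proof -
  have "(\<integral>\<^sup>+\<xi>. (envelope \<xi>)\<^sup>2 \<partial>lborel) \<le> (\<integral>\<^sup>+\<xi>. (SUP N. (cut_sup N \<xi>)\<^sup>2) \<partial>lborel)"
    unfolding envelope_def by (intro nn_integral_mono SUP_power2_le_ennreal)
  also have "\<dots> = (SUP N. \<integral>\<^sup>+\<xi>. (cut_sup N \<xi>)\<^sup>2 \<partial>lborel)"
  proof (rule nn_integral_monotone_convergence_SUP)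
    show "incseq (\<lambda>N \<xi>. (cut_sup N \<xi>)\<^sup>2)"
      unfolding cut_sup_def
      by (intro monoI le_funI power_mono mult_mono ennreal_leI low_cut_mono running_sup_mono) auto
  qed measurable
  also have "\<dots> \<le> 4 * L2_sq th0" by (intro SUP_least nn_integral_cut_sup_le)
  finally show ?thesis .
qed

text \<open>For fixed \<open>t\<close> and a nonzero frequency the truncations are inactive once
  \<open>N\<close> is large, so the supremum over \<open>N\<close> carries the full
  exponential.\<close>

lemma AE_th_le_envelope:
  assumes t: "t \<ge> 0"
  shows "AE \<xi> in lborel. ennreal (exp (t * norm \<xi> / 2) * cmod (th t \<xi>)) \<le> envelope \<xi>"
proof -
  obtain N0 :: nat where N0: "t \<le> real N0" using real_arch_simple by blast
  \<comment> \<open>The index \<open>N\<close> will depend on the frequency, so one null set must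
    serve all of the countably many \<open>N\<close>.\<close>
  have "AE \<xi> in lborel. \<forall>N\<ge>N0. weighted_mod (real N) \<xi> t \<le> running_sup (real N) (real N) \<xi>"
    unfolding AE_all_countable
  proof (intro allI)
    fix N
    show "AE \<xi> in lborel. N0 \<le> N \<longrightarrow> weighted_mod (real N) \<xi> t \<le> running_sup (real N) (real N) \<xi>"
    proof (cases "N0 \<le> N")
      case True
      then show ?thesis using AE_weighted_mod_le_running_sup[of t "real N" "real N"] t N0 by simp
    qed simp
  qed
  then show ?thesis using AE_lborel_nonzero
  proof eventually_elim
    case (elim \<xi>)
    \<comment> \<open>\<open>1 / norm \<xi>\<close> makes the cutoff equal to 1,
      \<open>t * norm \<xi> / 2\<close> disables the truncation, and \<open>N0\<close> places
      \<open>t\<close> within the horizon.\<close>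
    obtain N :: nat where N: "max (real N0) (max (1 / norm \<xi>) (t * norm \<xi> / 2)) \<le> real N"
      using real_arch_simple by blast
    have "low_cut N \<xi> = 1" using N elim(2) by (simp add: low_cut_def field_simps)
    then have "cut_sup N \<xi> = running_sup (real N) (real N) \<xi>" by (simp add: cut_sup_def)
    moreover have "weighted_mod (real N) \<xi> t \<le> running_sup (real N) (real N) \<xi>" using elim(1) N by simp
    moreover have "weighted_mod (real N) \<xi> t = ennreal (exp (t * norm \<xi> / 2) * cmod (th t \<xi>))"
      using N by (simp add: weighted_mod_def)
    moreover have "cut_sup N \<xi> \<le> envelope \<xi>" unfolding envelope_def by (rule SUP_upper) simp
    ultimately show ?case by simp
  qed
qed

section \<open>Decay of the Gevrey and L^2 norms\<close>

lemma gev_sq_decay: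
  assumes L2: "L2_sq th0 < \<infinity>" and k: "k \<ge> 0"
  shows "((\<lambda>t. ennreal (t powr (2 * k)) * gev_sq a \<sigma> k (th t)) \<longlongrightarrow> 0) at_top"
proof -
  \<comment> \<open>The term \<open>- t * r\<close> comes from squaring the decay
    \<open>exp (- t * r / 2)\<close> of the solution; it compensates both the power of time and the
    Gevrey weight.\<close>
  define \<Phi> where "\<Phi> t r = (t * r) powr (2 * k) * exp (2 * a * r powr (1 / \<sigma>) - t * r)" for t r
  have [measurable]: "(\<lambda>\<xi>::real^2. \<Phi> t (norm \<xi>)) \<in> borel_measurable borel" for t
    unfolding \<Phi>_def by measurable
  obtain B where B: "\<And>r t. r \<ge> 0 \<Longrightarrow> t \<ge> 1 \<Longrightarrow> \<Phi> t r \<le> B"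
    using decay_multiplier_bounded[of "2 * a" "1 / \<sigma>" "2 * k"] a \<sigma> k unfolding \<Phi>_def by auto
  have U2: "(\<integral>\<^sup>+\<xi>. (envelope \<xi>)\<^sup>2 \<partial>lborel) < \<infinity>"
    by (rule le_less_trans[OF nn_integral_envelope_le]) (use L2 in \<open>simp add: ennreal_mult_less_top\<close>)
  have lim: "((\<lambda>t. \<integral>\<^sup>+\<xi>. ennreal (\<Phi> t (norm \<xi>)) * (envelope \<xi>)\<^sup>2 \<partial>lborel) \<longlongrightarrow> 0) at_top"
  proof (rule tendsto_at_topI_sequentially)
    fix X :: "nat \<Rightarrow> real" assume X: "filterlim X at_top sequentially"
    \<comment> \<open>The uniform bound on \<open>\<Phi>\<close> requires times at least 1; along
      \<open>X\<close> this changes only finitely many terms.\<close>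
    define Y where "Y n = max 1 (X n)" for n
    have ev: "\<forall>\<^sub>F n in sequentially. Y n = X n"
      using filterlim_at_top[THEN iffD1, OF X, rule_format, of 1]
      by eventually_elim (simp add: Y_def)
    then have Y: "filterlim Y at_top sequentially"
      using X by (subst filterlim_cong[OF refl refl])
    have "(\<lambda>n. \<integral>\<^sup>+\<xi>. ennreal (\<Phi> (Y n) (norm \<xi>)) * (envelope \<xi>)\<^sup>2 \<partial>lborel) \<longlonglongrightarrow> (\<integral>\<^sup>+\<xi>. 0 \<partial>(lborel :: (real^2) measure))"
    proof (rule nn_integral_dominated_convergence[where w = "\<lambda>\<xi>. ennreal B * (envelope \<xi>)\<^sup>2"])
      show "AE \<xi> in lborel. ennreal (\<Phi> (Y n) (norm \<xi>)) * (envelope \<xi>)\<^sup>2 \<le> ennreal B * (envelope \<xi>)\<^sup>2" for n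
        by (intro AE_I2 mult_right_mono ennreal_leI B) (auto simp: Y_def)
      show "(\<integral>\<^sup>+\<xi>. ennreal B * (envelope \<xi>)\<^sup>2 \<partial>lborel) < \<infinity>"
        using U2 by (simp add: nn_integral_cmult ennreal_mult_less_top)
      \<comment> \<open>The limit 0 of the multiplier passes to the product where the envelope is
        finite.\<close>
      have "AE \<xi> in lborel. (envelope \<xi>)\<^sup>2 \<noteq> \<infinity>"
        using U2 by (intro nn_integral_noteq_infinite) auto
      then show "AE \<xi> in lborel. (\<lambda>n. ennreal (\<Phi> (Y n) (norm \<xi>)) * (envelope \<xi>)\<^sup>2) \<longlonglongrightarrow> 0"
        using AE_lborel_nonzero
      proof eventually_elim
        case (elim \<xi>)
        obtain u where u: "(envelope \<xi>)\<^sup>2 = ennreal u" "u \<ge> 0" using elim(1) by (cases "(envelope \<xi>)\<^sup>2") auto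
        have "(\<lambda>n. \<Phi> (Y n) (norm \<xi>)) \<longlonglongrightarrow> 0"
          unfolding \<Phi>_def
          by (rule filterlim_compose[OF decay_multiplier_tendsto_0 Y]) (use elim in simp)
        then have "(\<lambda>n. ennreal (\<Phi> (Y n) (norm \<xi>) * u)) \<longlonglongrightarrow> ennreal 0"
          by (intro tendsto_ennrealI tendsto_mult_left_zero)
        then show ?case using u by (simp add: ennreal_mult'')
      qed
    qed measurable
    then have "(\<lambda>n. \<integral>\<^sup>+\<xi>. ennreal (\<Phi> (Y n) (norm \<xi>)) * (envelope \<xi>)\<^sup>2 \<partial>lborel) \<longlonglongrightarrow> 0"
      by simp
    then show "(\<lambda>n. \<integral>\<^sup>+\<xi>. ennreal (\<Phi> (X n) (norm \<xi>)) * (envelope \<xi>)\<^sup>2 \<partial>lborel) \<longlonglongrightarrow> 0"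
      by (rule Lim_transform_eventually) (rule eventually_mono[OF ev], simp)
  qed
  have bound: "ennreal (t powr (2 * k)) * gev_sq a \<sigma> k (th t) \<le> (\<integral>\<^sup>+\<xi>. ennreal (\<Phi> t (norm \<xi>)) * (envelope \<xi>)\<^sup>2 \<partial>lborel)"
    if t: "t \<ge> 0" for t
  proof -
    have [measurable]: "th t \<in> borel_measurable borel" using t by (rule th_measurable)
    have "ennreal (t powr (2 * k)) * gev_sq a \<sigma> k (th t)
        = (\<integral>\<^sup>+\<xi>. ennreal (t powr (2 * k)) * ennreal (gev_weight a \<sigma> k \<xi> * (cmod (th t \<xi>))\<^sup>2) \<partial>lborel)"
      unfolding gev_sq_def by (rule nn_integral_cmult[symmetric]) measurable
    also have "\<dots> \<le> (\<integral>\<^sup>+\<xi>. ennreal (\<Phi> t (norm \<xi>)) * (envelope \<xi>)\<^sup>2 \<partial>lborel)"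
    proof (rule nn_integral_mono_AE, use AE_th_le_envelope[OF t] in eventually_elim)
      case (elim \<xi>)
      let ?x = "exp (t * norm \<xi> / 2) * cmod (th t \<xi>)"
      have "exp (t * norm \<xi>) = (exp (t * norm \<xi> / 2))\<^sup>2"
        by (simp flip: exp_double)
      then have "t powr (2 * k) * (gev_weight a \<sigma> k \<xi> * (cmod (th t \<xi>))\<^sup>2) = \<Phi> t (norm \<xi>) * ?x\<^sup>2"
        using t by (simp add: \<Phi>_def gev_weight_def powr_mult exp_diff power_mult_distrib)
      then have "ennreal (t powr (2 * k)) * ennreal (gev_weight a \<sigma> k \<xi> * (cmod (th t \<xi>))\<^sup>2)
          = ennreal (\<Phi> t (norm \<xi>)) * (ennreal ?x)\<^sup>2"
        by (simp add: ennreal_power \<Phi>_def gev_weight_def flip: ennreal_mult)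
      also have "\<dots> \<le> ennreal (\<Phi> t (norm \<xi>)) * (envelope \<xi>)\<^sup>2"
        using elim by (intro mult_left_mono power_mono) auto
      finally show ?case .
    qed
    finally show ?thesis .
  qed
  show ?thesis
  proof (rule tendsto_sandwich[OF _ _ tendsto_const lim])
    show "\<forall>\<^sub>F t in at_top. ennreal (t powr (2 * k)) * gev_sq a \<sigma> k (th t)
        \<le> (\<integral>\<^sup>+\<xi>. ennreal (\<Phi> t (norm \<xi>)) * (envelope \<xi>)\<^sup>2 \<partial>lborel)"
      using eventually_ge_at_top[of 0] by eventually_elim (rule bound)
  qed simp
qed

lemma gev_norm_decay:
  assumes L2: "L2_sq th0 < \<infinity>" and k: "k \<ge> 0"
  shows "((\<lambda>t. ennreal (t powr k) * gev_norm a \<sigma> k (th t)) \<longlongrightarrow> 0) at_top"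
proof (rule tendsto_zero_if_power2_tendsto_zero)
  have "(ennreal (t powr k) * gev_norm a \<sigma> k (th t))\<^sup>2 = ennreal (t powr (2 * k)) * gev_sq a \<sigma> k (th t)" for t
  proof -
    have "(t powr k)\<^sup>2 = t powr (2 * k)" by (simp add: power2_eq_square flip: powr_add)
    then show ?thesis by (simp add: power_mult_distrib gev_norm_def power2_ennsqrt ennreal_power)
  qed
  then show "((\<lambda>t. (ennreal (t powr k) * gev_norm a \<sigma> k (th t))\<^sup>2) \<longlongrightarrow> 0) at_top"
    using gev_sq_decay[OF assms] by simp
qed

lemma L2_norm_decay:
  assumes L2: "L2_sq th0 < \<infinity>"
  shows "((\<lambda>t. L2_norm (th t)) \<longlongrightarrow> 0) at_top"
proof -
  have "L2_sq (th t) \<le> gev_sq a \<sigma> 0 (th t)" for t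
    unfolding L2_sq_def gev_sq_def
  proof (rule nn_integral_mono_AE, use AE_lborel_nonzero in eventually_elim)
    case (elim \<xi>)
    \<comment> \<open>At frequency 0 this fails, because \<open>0 powr 0\<close> is 0 by
      convention.\<close>
    then have "1 \<le> gev_weight a \<sigma> 0 \<xi>" using a by (simp add: gev_weight_def)
    from mult_right_mono[OF this, of "(cmod (th t \<xi>))\<^sup>2"] show ?case by (intro ennreal_leI) simp
  qed
  then have le: "ennsqrt (L2_sq (th t)) \<le> gev_norm a \<sigma> 0 (th t)" for t
    unfolding gev_norm_def by - (rule ennreal_power2_le_cancel, simp add: power2_ennsqrt)
  have "\<forall>\<^sub>F t in at_top. ennreal (t powr 0) * gev_norm a \<sigma> 0 (th t) = gev_norm a \<sigma> 0 (th t)"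
    using eventually_gt_at_top[of 0] by eventually_elim simp
  then have lim: "((\<lambda>t. gev_norm a \<sigma> 0 (th t)) \<longlongrightarrow> 0) at_top"
    by (rule Lim_transform_eventually[OF gev_norm_decay[OF L2 order_refl]])
  have "((\<lambda>t. ennsqrt (L2_sq (th t))) \<longlongrightarrow> 0) at_top"
    by (rule tendsto_sandwich[OF _ _ tendsto_const lim]) (simp_all add: le)
  then have "((\<lambda>t. ennreal (1 / (2 * pi)) * ennsqrt (L2_sq (th t))) \<longlongrightarrow> ennreal (1 / (2 * pi)) * 0) at_top"
    by (intro tendsto_mult_ennreal) auto
  then show ?thesis by (simp add: L2_norm_def)
qed

end

section \<open>Choice of the smallness constant and conclusion\<close>

theorem theorem3:
  fixes a \<sigma> s :: real
  assumes "a > 0" and "\<sigma> > 1" and "0 \<le> s" and "s < 1"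
  shows "\<exists>C>0. \<forall>th0 th.
           in_L2 th0 \<and> in_Hdot a \<sigma> s th0 \<and> real_valued_hat th0
         \<and> gev_norm a \<sigma> s th0 < ennreal C
         \<and> in_sol_space a \<sigma> s th \<and> is_mild_sol th0 th
         \<longrightarrow> ((\<lambda>t. L2_norm (th t)) \<longlongrightarrow> 0) at_top
           \<and> (\<forall>\<kappa>\<ge>0. Limsup at_top (\<lambda>t. ennreal (t powr \<kappa>) * gev_norm a \<sigma> \<kappa> (th t)) = 0)"
proof -
  have "gev_recip a \<sigma> s < \<infinity>"
    unfolding gev_recip_def
    by (rule nn_integral_powr_exp_plane_finite) (use assms in auto)
  then obtain I where I: "gev_recip a \<sigma> s = ennreal I" "I \<ge> 0"
    by (cases "gev_recip a \<sigma> s") auto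
  \<comment> \<open>With \<open>C\<^sup>2 * I \<le> 1\<close> the embedding turns Gevrey smallness
    into an L^1 norm of at most 1; adding 1 keeps the denominator positive even for
    \<open>I = 0\<close>.\<close>
  define C where "C = 1 / sqrt (I + 1)"
  have C: "C > 0" "C\<^sup>2 * I \<le> 1" using I by (auto simp: C_def power_divide)
  show ?thesis
  proof (intro exI[of _ C] conjI C allI impI)
    fix th0 :: "real^2 \<Rightarrow> complex" and th :: "real \<Rightarrow> real^2 \<Rightarrow> complex"
    assume H: "in_L2 th0 \<and> in_Hdot a \<sigma> s th0 \<and> real_valued_hat th0
         \<and> gev_norm a \<sigma> s th0 < ennreal C
         \<and> in_sol_space a \<sigma> s th \<and> is_mild_sol th0 th"
    then have [measurable]: "th0 \<in> borel_measurable borel" by (auto simp: in_L2_def)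
    have L2: "L2_sq th0 < \<infinity>" using H by (auto simp: in_L2_def)
    have "(\<integral>\<^sup>+\<xi>. ennreal (cmod (th0 \<xi>)) \<partial>lborel)\<^sup>2
        \<le> (\<integral>\<^sup>+\<xi>. ennreal (gev_weight a \<sigma> s \<xi>) * (ennreal (cmod (th0 \<xi>)))\<^sup>2 \<partial>lborel) * gev_recip a \<sigma> s"
      by (rule power2_nn_integral_le_gev) measurable
    also have "(\<integral>\<^sup>+\<xi>. ennreal (gev_weight a \<sigma> s \<xi>) * (ennreal (cmod (th0 \<xi>)))\<^sup>2 \<partial>lborel) = (gev_norm a \<sigma> s th0)\<^sup>2"
      by (simp add: gev_norm_def power2_ennsqrt gev_sq_def ennreal_power ennreal_mult'')
    also have "(gev_norm a \<sigma> s th0)\<^sup>2 * gev_recip a \<sigma> s \<le> (ennreal C)\<^sup>2 * gev_recip a \<sigma> s"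
      using H by (intro mult_right_mono power_mono) auto
    also have "\<dots> = ennreal (C\<^sup>2 * I)"
      using C I by (simp add: ennreal_power ennreal_mult)
    also have "\<dots> \<le> 1\<^sup>2" using C by (simp add: ennreal_le_1)
    finally have small: "(\<integral>\<^sup>+\<xi>. ennreal (cmod (th0 \<xi>)) \<partial>lborel) \<le> 1"
      by (rule ennreal_power2_le_cancel)
    interpret small_qg_solution a \<sigma> s th0 th
      by unfold_locales (use assms H small in auto)
    show "((\<lambda>t. L2_norm (th t)) \<longlongrightarrow> 0) at_top" by (rule L2_norm_decay[OF L2])
    show "Limsup at_top (\<lambda>t. ennreal (t powr \<kappa>) * gev_norm a \<sigma> \<kappa> (th t)) = 0" if "\<kappa> \<ge> 0" for \<kappa>
      by (rule lim_imp_Limsup[OF _ gev_norm_decay[OF L2 that]]) simp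
  qed
qed

end
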